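(* Let $\boldsymbol{M}$ be the Polish space of all infinite minimal subshifts with some finite alphabet $\mathsf{A}\subseteq\mathbb{Z}$. The set of all strong Toeplitz subshifts of finite rank is generic in $\boldsymbol{M}$.
   Context: **Subshifts.** For a finite alphabet $\mathsf{A}$, $S$ is the shift on $\mathsf{A}^{\mathbb{Z}}$, $S(x)(i)=x(i+1)$. A subshift is a closed set $X\subseteq\mathsf{A}^{\mathbb{Z}}$ with $S(X)=X$; it is minimal if every $S$-orbit is dense. Subshifts $X,Y$ are conjugate if there is a homeomorphism $\varphi\colon X\to Y$ with $\varphi\circ S=S\circ\varphi$. **The space.** Let $\boldsymbol{S}$ be the space of all subshifts with some finite alphabet $\mathsf{A}\subseteq\mathbb{Z}$, with metric $d(X,Y)=2^{-\inf\{n\,:\,L_n(X)\neq L_n(Y)\}}$, where $L_n(X)$ is the set of words of length $n$ occurring in elements of $X$. It is Polish, and $\boldsymbol{M}\subseteq\boldsymbol{S}$, the set of infinite minimal subshifts with the subspace topology, is a $G_\delta$ subset, hence Polish. A subset of a Polish space is generic if it contains a dense $G_\delta$ subset. **Strong Toeplitz subshifts.** A morphism $\tau\colon A^*\to B^*$ between sets of finite words over finite alphabets satisfies $\tau(uv)=\tau(u)\tau(v)$; all morphisms are non-erasing ($\tau(a)$ is nonempty for all $a\in A$). For $y\in A^{\mathbb{Z}}$, $\tau(y)=\cdots\tau(y(-1)).\tau(y(0))\tau(y(1))\cdots$, where the dot marks that position $0$ is the start of $\tau(y(0))$. A directive sequence is a sequence of morphisms $\boldsymbol{\tau}=(\tau_n\colon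 A_{n+1}^*\to A_n^* )_{n\geq0}$; put $\tau_{[n,N)}=\tau_n\circ\cdots\circ\tau_{N-1}$. $X^{(n)}_{\boldsymbol{\tau}}$ is the set of $x\in A_n^{\mathbb{Z}}$ such that every finite subword of $x$ occurs in $\tau_{[n,N)}(a)$ for some $N>n$, $a\in A_N$; $X_{\boldsymbol{\tau}}=X^{(0)}_{\boldsymbol{\tau}}$ is the $\mathcal{S}$-adic subshift generated by $\boldsymbol{\tau}$. The alphabet rank of $\boldsymbol{\tau}$ is $\liminf_n|A_n|$. $\boldsymbol{\tau}$ is: constant-length if for each $n$, $|\tau_n(a)|$ does not depend on $a\in A_{n+1}$; primitive if for every $n$ there is $N>n$ such that all letters of $A_n$ occur in $\tau_{[n,N)}(a)$ for all $a\in A_N$; proper if for each $n$ all words $\tau_n(a)$, $a\in A_{n+1}$, start with the same letter and end with the same letter; recognizable if for each $n$ every $x\in A_n^{\mathbb{Z}}$ admits at most one pair $(y,k)$ with $y\in X^{(n+1)}_{\boldsymbol{\tau}}$, $0\leq k<|\tau_n(y(0))|$ and $x=S^k\tau_n(y)$. For $K\geq2$, a strong Toeplitz subshift of rank $K$ is a subshift conjugate to an $\mathcal{S}$-adic subshift generated by a constant-length, primitive, proper and recognizable directive sequence of alphabet rank $k\leq K$; a strong Toeplitz subshift of finite rank is one that is a strong Toeplitz subshift of rank $K$ for some $K$. *)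

theory Defs
  imports "HOL-Analysis.Analysis" "HOL-Library.Sublist" "HOL-Library.Extended_Nat"
begin

section \<open>Subshifts\<close>

definition shift_by :: "int \<Rightarrow> (int \<Rightarrow> 'a) \<Rightarrow> int \<Rightarrow> 'a" where
  "shift_by k x = (\<lambda>i. x (i + k))"

abbreviation shift :: "(int \<Rightarrow> 'a) \<Rightarrow> int \<Rightarrow> 'a" where
  "shift \<equiv> shift_by 1"

definition full_shift :: "'a set \<Rightarrow> (int \<Rightarrow> 'a) set" where
  "full_shift A = {x. \<forall>i. x i \<in> A}"

text \<open>The type \<^typ>\<open>int\<close> is discrete and \<^typ>\<open>int \<Rightarrow> int\<close> carries the product topology. Full shifts
  are closed in it, so being closed in a full shift is the same as being closed.\<close>

definition subshifts :: "(int \<Rightarrow> int) set set" where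
  "subshifts = {X. closed X \<and> shift ` X = X \<and> (\<exists>A. finite A \<and> X \<subseteq> full_shift A)}"

definition shift_orbit :: "(int \<Rightarrow> 'a) \<Rightarrow> (int \<Rightarrow> 'a) set" where
  "shift_orbit x = range (\<lambda>k. shift_by k x)"

definition infinite_minimal_subshifts :: "(int \<Rightarrow> int) set set" where
  "infinite_minimal_subshifts =
     {X \<in> subshifts. infinite X \<and> (\<forall>x\<in>X. closure (shift_orbit x) = X)}"

definition conjugate_subshifts :: "(int \<Rightarrow> int) set \<Rightarrow> (int \<Rightarrow> int) set \<Rightarrow> bool" where
  "conjugate_subshifts X Y \<longleftrightarrow>
     (\<exists>\<phi> \<psi>. homeomorphism X Y \<phi> \<psi> \<and> (\<forall>x\<in>X. \<phi> (shift x) = shift (\<phi> x)))"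

definition window :: "(int \<Rightarrow> 'a) \<Rightarrow> int \<Rightarrow> nat \<Rightarrow> 'a list" where
  "window x i n = map (\<lambda>j. x (i + int j)) [0..<n]"

definition language :: "nat \<Rightarrow> (int \<Rightarrow> 'a) set \<Rightarrow> 'a list set" where
  "language n X = {window x i n |x i. x \<in> X}"


section \<open>The space of subshifts\<close>

text \<open>The case distinction expresses the convention \<open>2\<^sup>-\<^sup>\<infinity> = 0\<close>: on \<^typ>\<open>nat\<close> the infimum of the
  empty set is unspecified.\<close>

definition subshift_dist :: "(int \<Rightarrow> int) set \<Rightarrow> (int \<Rightarrow> int) set \<Rightarrow> real" where
  "subshift_dist X Y =
     (if \<forall>n. language n X = language n Y then 0
      else (1/2) ^ Inf {n. language n X \<noteq> language n Y})"

lemma length_window [simp]: "length (window x i n) = n"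
  by (simp add: window_def)

lemma nth_window [simp]: "j < n \<Longrightarrow> window x i n ! j = x (i + int j)"
  by (simp add: window_def)

lemma shift_by_subshift:
  assumes "X \<in> subshifts" "x \<in> X"
  shows "shift_by k x \<in> X"
proof -
  have sX: "shift ` X = X"
    using assms(1) by (simp add: subshifts_def)
  have fwd: "shift_by (int n) y \<in> X" if "y \<in> X" for n y
  proof (induction n)
    case 0
    then show ?case using that by (simp add: shift_by_def)
  next
    case (Suc n)
    have "shift_by (int (Suc n)) y = shift (shift_by (int n) y)"
      by (auto simp: shift_by_def algebra_simps)
    then show ?case using Suc sX by blast
  qed
  have bwd: "\<exists>z\<in>X. y = shift_by (int n) z" if "y \<in> X" for n y
    using that
  proof (induction n arbitrary: y)
    case 0
    then show ?case by (auto simp: shift_by_def)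
  next
    case (Suc n)
    then obtain z where z: "z \<in> X" "y = shift_by (int n) z" by blast
    then obtain z' where z': "z' \<in> X" "z = shift z'" using sX by blast
    have "y = shift_by (int (Suc n)) z'"
      using z z' by (auto simp: shift_by_def algebra_simps)
    then show ?case using z' by blast
  qed
  show ?thesis
  proof (cases "k \<ge> 0")
    case True
    then show ?thesis using fwd[OF assms(2), of "nat k"] by simp
  next
    case False
    obtain z where z: "z \<in> X" "x = shift_by (int (nat (- k))) z"
      using bwd[OF assms(2)] by blast
    have "shift_by k x = z"
      using z False by (auto simp: shift_by_def)
    then show ?thesis using z by simp
  qed
qed

lemma subshift_eqI:
  assumes X: "X \<in> subshifts" and Y: "Y \<in> subshifts"
    and L: "\<And>n. language n X = language n Y"
  shows "X = Y"
proof -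
  have "X \<subseteq> Y" if Y: "Y \<in> subshifts" and L: "\<And>n. language n X = language n Y"
    for X Y :: "(int \<Rightarrow> int) set"
  proof
    fix x assume x: "x \<in> X"
    have "\<exists>y\<in>Y. \<forall>i. \<bar>i\<bar> \<le> int n \<longrightarrow> y i = x i" for n
    proof -
      have "window x (- int n) (2 * n + 1) \<in> language (2 * n + 1) Y"
        unfolding L[symmetric] using x by (force simp: language_def)
      then obtain y j where y: "y \<in> Y" "window x (- int n) (2 * n + 1) = window y j (2 * n + 1)"
        unfolding language_def by blast
      have "shift_by (j + int n) y i = x i" if "\<bar>i\<bar> \<le> int n" for i
      proof -
        have "nat (i + int n) < 2 * n + 1" using that by linarith
        then have "x (- int n + int (nat (i + int n))) = y (j + int (nat (i + int n)))"
          using y(2) by (metis nth_window)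
        moreover have "0 \<le> i + int n" using that by linarith
        ultimately show ?thesis by (simp add: shift_by_def algebra_simps)
      qed
      then show ?thesis using shift_by_subshift[OF Y y(1)] by blast
    qed
    then obtain y where y: "\<And>n. y n \<in> Y" "\<And>n i. \<bar>i\<bar> \<le> int n \<Longrightarrow> y n i = x i"
      by metis
    have "(\<lambda>n. y n i) \<longlonglongrightarrow> x i" for i
      by (rule tendsto_eventually)
        (auto intro!: y(2) eventually_sequentiallyI[of "nat \<bar>i\<bar>"])
    then have "limitin (product_topology (\<lambda>_. euclidean) UNIV) y x sequentially"
      by (auto simp: limitin_componentwise)
    then have "y \<longlonglongrightarrow> x"
      by (simp add: euclidean_product_topology)
    moreover have "closed Y" using Y by (simp add: subshifts_def)
    ultimately show "x \<in> Y"
      using y(1) closed_sequentially by blast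
  qed
  then show ?thesis using assms by (metis subset_antisym)
qed

interpretation subshift_space: Metric_space subshifts subshift_dist
proof
  fix X Y Z :: "(int \<Rightarrow> int) set"
  show "0 \<le> subshift_dist X Y"
    by (simp add: subshift_dist_def)
  show "subshift_dist X Y = subshift_dist Y X"
    unfolding subshift_dist_def by (simp only: eq_commute[of "language _ X"])
  show "subshift_dist X Y = 0 \<longleftrightarrow> X = Y" if "X \<in> subshifts" "Y \<in> subshifts"
    using that subshift_eqI[of X Y] by (auto simp: subshift_dist_def)
  show "subshift_dist X Z \<le> subshift_dist X Y + subshift_dist Y Z"
  proof (cases "\<forall>n. language n X = language n Z")
    case True
    then show ?thesis by (simp add: subshift_dist_def)
  next
    case False
    define m where "m = Inf {n. language n X \<noteq> language n Z}"
    have m: "language m X \<noteq> language m Z"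
      using Inf_nat_def1[of "{n. language n X \<noteq> language n Z}"] False by (auto simp: m_def)
    have ge: "(1/2) ^ m \<le> subshift_dist U V" if "language m U \<noteq> language m V" for U V
    proof -
      have "Inf {n. language n U \<noteq> language n V} \<le> m"
        using that by (intro cInf_lower) auto
      then show ?thesis
        using that by (auto simp: subshift_dist_def intro: power_decreasing)
    qed
    have nonneg: "0 \<le> subshift_dist U V" for U V
      by (simp add: subshift_dist_def)
    have "subshift_dist X Z = (1/2) ^ m"
      using False by (simp add: subshift_dist_def m_def)
    then show ?thesis
      using m ge[of X Y] ge[of Y Z] nonneg[of X Y] nonneg[of Y Z]
      by (cases "language m X = language m Y") auto
  qed
qed

definition minimal_topology :: "(int \<Rightarrow> int) set topology" where
  "minimal_topology = subtopology subshift_space.mtopology infinite_minimal_subshifts"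

definition generic_in :: "'a topology \<Rightarrow> 'a set \<Rightarrow> bool" where
  "generic_in T U \<longleftrightarrow>
     U \<subseteq> topspace T \<and> (\<exists>G \<subseteq> U. gdelta_in T G \<and> T closure_of G = topspace T)"


section \<open>Morphisms and directive sequences\<close>

definition morphism :: "'a set \<Rightarrow> 'b set \<Rightarrow> ('a list \<Rightarrow> 'b list) \<Rightarrow> bool" where
  "morphism A B \<tau> \<longleftrightarrow>
     (\<forall>u\<in>lists A. \<tau> u \<in> lists B) \<and>
     (\<forall>u\<in>lists A. \<forall>v\<in>lists A. \<tau> (u @ v) = \<tau> u @ \<tau> v) \<and>
     (\<forall>a\<in>A. \<tau> [a] \<noteq> [])"

text \<open>\<open>block_start \<tau> y k\<close> is the position in \<open>\<tau>(y)\<close> at which the block \<open>\<tau>(y(k))\<close> starts, normalised by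
  \<open>block_start \<tau> y 0 = 0\<close>. For non-erasing \<open>\<tau>\<close> the blocks partition the integers, so the definite
  description below denotes the index of the block covering position \<open>i\<close>
  (see \<open>apply_biinf_block\<close>).\<close>

definition block_start :: "('a list \<Rightarrow> 'b list) \<Rightarrow> (int \<Rightarrow> 'a) \<Rightarrow> int \<Rightarrow> int" where
  "block_start \<tau> y k = (\<Sum>j\<in>{0..<k}. int (length (\<tau> [y j]))) - (\<Sum>j\<in>{k..<0}. int (length (\<tau> [y j])))"

definition apply_biinf :: "('a list \<Rightarrow> 'b list) \<Rightarrow> (int \<Rightarrow> 'a) \<Rightarrow> int \<Rightarrow> 'b" where
  "apply_biinf \<tau> y i =
     (let k = (THE k. block_start \<tau> y k \<le> i \<and> i < block_start \<tau> y (k + 1)) in \<tau> [y k] ! nat (i - block_start \<tau> y k))"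

lemma block_start_0 [simp]: "block_start \<tau> y 0 = 0"
  by (simp add: block_start_def)

lemma block_start_plus_1: "block_start \<tau> y (k + 1) = block_start \<tau> y k + int (length (\<tau> [y k]))"
proof (cases "k \<ge> 0")
  case True
  then have "{0..<k + 1} = insert k {0..<k}" by auto
  then show ?thesis using True by (simp add: block_start_def)
next
  case False
  then have "{k..<0} = insert k {k + 1..<0}" by auto
  then show ?thesis using False by (simp add: block_start_def)
qed

lemma apply_biinf_block:
  assumes ne: "\<And>j. \<tau> [y j] \<noteq> []" and i: "i < length (\<tau> [y k])"
  shows "apply_biinf \<tau> y (block_start \<tau> y k + int i) = \<tau> [y k] ! i"
proof -
  have step: "block_start \<tau> y j < block_start \<tau> y (j + 1)" for j
    using ne[of j] by (simp add: block_start_plus_1)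
  have mono: "block_start \<tau> y j \<le> block_start \<tau> y l" if "j \<le> l" for j l
    using that
  proof (induction rule: int_ge_induct)
    case base
    then show ?case by simp
  next
    case (step l)
    then show ?case using \<open>\<And>j. block_start \<tau> y j < block_start \<tau> y (j + 1)\<close>[of l] by linarith
  qed
  have "(THE j. block_start \<tau> y j \<le> block_start \<tau> y k + int i \<and> block_start \<tau> y k + int i < block_start \<tau> y (j + 1)) = k"
  proof (rule the_equality)
    show "block_start \<tau> y k \<le> block_start \<tau> y k + int i \<and> block_start \<tau> y k + int i < block_start \<tau> y (k + 1)"
      using i by (simp add: block_start_plus_1)
  next
    fix j assume j: "block_start \<tau> y j \<le> block_start \<tau> y k + int i \<and> block_start \<tau> y k + int i < block_start \<tau> y (j + 1)"
    have "block_start \<tau> y k + int i < block_start \<tau> y (k + 1)" using i by (simp add: block_start_plus_1)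
    then have "\<not> k + 1 \<le> j" using mono[of "k + 1" j] j by linarith
    moreover have "\<not> j + 1 \<le> k" using mono[of "j + 1" k] j by linarith
    ultimately show "j = k" by linarith
  qed
  then show ?thesis by (simp add: apply_biinf_def)
qed

text \<open>Alphabets of directive sequences are taken to be finite nonempty sets of integers; every
  finite alphabet can be renamed into such a set.\<close>

definition directive_sequence :: "(nat \<Rightarrow> int set) \<Rightarrow> (nat \<Rightarrow> int list \<Rightarrow> int list) \<Rightarrow> bool" where
  "directive_sequence A \<tau> \<longleftrightarrow>
     (\<forall>n. finite (A n) \<and> A n \<noteq> {} \<and> morphism (A (Suc n)) (A n) (\<tau> n))"

definition compose_range :: "(nat \<Rightarrow> 'a list \<Rightarrow> 'a list) \<Rightarrow> nat \<Rightarrow> nat \<Rightarrow> 'a list \<Rightarrow> 'a list" where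
  "compose_range \<tau> n N = foldr (\<circ>) (map \<tau> [n..<N]) id"

definition sadic_level ::
    "(nat \<Rightarrow> int set) \<Rightarrow> (nat \<Rightarrow> int list \<Rightarrow> int list) \<Rightarrow> nat \<Rightarrow> (int \<Rightarrow> int) set" where
  "sadic_level A \<tau> n =
     {x \<in> full_shift (A n).
        \<forall>i l. \<exists>N>n. \<exists>a\<in>A N. sublist (window x i l) (compose_range \<tau> n N [a])}"

definition sadic_subshift ::
    "(nat \<Rightarrow> int set) \<Rightarrow> (nat \<Rightarrow> int list \<Rightarrow> int list) \<Rightarrow> (int \<Rightarrow> int) set" where
  "sadic_subshift A \<tau> = sadic_level A \<tau> 0"

definition alphabet_rank :: "(nat \<Rightarrow> int set) \<Rightarrow> enat" where
  "alphabet_rank A = liminf (\<lambda>n. enat (card (A n)))"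

definition constant_length ::
    "(nat \<Rightarrow> int set) \<Rightarrow> (nat \<Rightarrow> int list \<Rightarrow> int list) \<Rightarrow> bool" where
  "constant_length A \<tau> \<longleftrightarrow>
     (\<forall>n. \<forall>a\<in>A (Suc n). \<forall>b\<in>A (Suc n). length (\<tau> n [a]) = length (\<tau> n [b]))"

definition primitive :: "(nat \<Rightarrow> int set) \<Rightarrow> (nat \<Rightarrow> int list \<Rightarrow> int list) \<Rightarrow> bool" where
  "primitive A \<tau> \<longleftrightarrow> (\<forall>n. \<exists>N>n. \<forall>a\<in>A N. A n \<subseteq> set (compose_range \<tau> n N [a]))"

definition proper :: "(nat \<Rightarrow> int set) \<Rightarrow> (nat \<Rightarrow> int list \<Rightarrow> int list) \<Rightarrow> bool" where
  "proper A \<tau> \<longleftrightarrow>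
     (\<forall>n. \<forall>a\<in>A (Suc n). \<forall>b\<in>A (Suc n).
        hd (\<tau> n [a]) = hd (\<tau> n [b]) \<and> last (\<tau> n [a]) = last (\<tau> n [b]))"

definition recognizable :: "(nat \<Rightarrow> int set) \<Rightarrow> (nat \<Rightarrow> int list \<Rightarrow> int list) \<Rightarrow> bool" where
  "recognizable A \<tau> \<longleftrightarrow>
     (\<forall>n. \<forall>x\<in>full_shift (A n).
        \<exists>\<^sub>\<le>\<^sub>1 (y, k). y \<in> sadic_level A \<tau> (Suc n) \<and> 0 \<le> k \<and> k < int (length (\<tau> n [y 0])) \<and>
          x = shift_by k (apply_biinf (\<tau> n) y))"


section \<open>Strong Toeplitz subshifts\<close>

definition strong_Toeplitz_rank :: "nat \<Rightarrow> (int \<Rightarrow> int) set \<Rightarrow> bool" where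
  "strong_Toeplitz_rank K X \<longleftrightarrow>
     X \<in> subshifts \<and>
     (\<exists>A \<tau>. directive_sequence A \<tau> \<and> constant_length A \<tau> \<and> primitive A \<tau> \<and> proper A \<tau> \<and>
        recognizable A \<tau> \<and> alphabet_rank A \<le> enat K \<and> conjugate_subshifts X (sadic_subshift A \<tau>))"

definition strong_Toeplitz_finite_rank :: "(int \<Rightarrow> int) set \<Rightarrow> bool" where
  "strong_Toeplitz_finite_rank X \<longleftrightarrow> (\<exists>K\<ge>2. strong_Toeplitz_rank K X)"

end

theory Submission
  imports Defs
begin

text \<open>
Call a subshift tilable at scale \<open>m\<close> if there are two words \<open>u\<close> and \<open>v\<close> with a common prefix of length
\<open>m\<close> and with the same length, a multiple of \<open>m\<close>, such that each point has exactly one occurrence of \<open>u\<close> or \<open>v\<close>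
starting in any given interval of \<open>length u\<close> positions. The dense \<open>G\<^sub>\<delta>\<close> set is the set of all infinite minimal
subshifts that are tilable at all scales \<open>m > 0\<close>. It is a \<open>G\<^sub>\<delta>\<close> because tilability by given words \<open>u\<close> and \<open>v\<close>
is decided by the words of length \<open>2 * length u\<close> (\<open>tiled_by_local\<close>).

Its members are strong Toeplitz subshifts of rank \<open>2\<close> (\<open>tilable_imp_strong_Toeplitz\<close>). The starts of the
occurrences of \<open>u\<close> and \<open>v\<close> in a point form one residue class modulo \<open>length u\<close>, so each point is cut into
copies of \<open>u\<close> and \<open>v\<close>, in one way only. Given a cutting into blocks of length \<open>l\<close>, tilability at scale \<open>3 * l\<close> provides a
coarser one. The common prefix leaves room to move its cuts onto cuts of the given one, and to do so
in such a way that all cuts are preceded, and all are followed, by the same block of length \<open>l\<close>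
(\<open>tower_step_exists\<close>). Coding the blocks at all scales by letters gives a directive sequence with at most two
letters at each positive level. It is recognizable because of the uniqueness of the cuttings, proper because
of the blocks next to the cuts, and primitive because of minimality, which also shows that it generates the given
subshift (\<open>block_tower.strong_Toeplitz\<close>).

Density (\<open>tilable_dense\<close>) comes from an explicit construction. A point of an infinite minimal subshift \<open>X\<close> is
not periodic, so it provides two different words \<open>a\<close> and \<open>b\<close>, repetitions of return loops of one word of length \<open>n\<close>,
with the same length and such that the words of length \<open>n\<close> in all concatenations of \<open>a\<close> and \<open>b\<close> are
words of \<open>X\<close>; moreover \<open>b\<close> can be chosen to involve all of these. Now replace \<open>a\<close> and \<open>b\<close> by \<open>a\<^sup>K b b\<close> and \<open>a\<^sup>K b a\<close>, and repeat
this with growing \<open>K\<close>. The limit is an infinite minimal subshift with the same words of length \<open>n\<close> as \<open>X\<close>. It is tilable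
at all scales since two occurrences of \<open>a\<^sup>K b\<close> cannot be close to each other
(\<open>marked_run_separation\<close>).
\<close>

section \<open>Windows\<close>

lemma window_eqI:
  assumes "\<And>t. t < l \<Longrightarrow> x (i + int t) = y (j + int t)"
  shows "window x i l = window y j l"
  using assms by (simp add: window_def)

lemma window_eqD: "window x i l = window y j l \<Longrightarrow> t < l \<Longrightarrow> x (i + int t) = y (j + int t)"
  by (metis nth_window)

lemma window_eq_nthI:
  assumes "length w = l" "\<And>t. t < l \<Longrightarrow> x (i + int t) = w ! t"
  shows "window x i l = w"
  using assms by (intro nth_equalityI) auto

lemma window_eq_sub:
  assumes "window x i L = window y j L" "a + l \<le> L"
  shows "window x (i + int a) l = window y (j + int a) l"
proof (rule window_eqI)
  fix t assume "t < l"
  then show "x (i + int a + int t) = y (j + int a + int t)"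
    using window_eqD[OF assms(1), of "a + t"] assms(2) by (simp add: add.assoc)
qed

lemma window_shift_by [simp]: "window (shift_by k x) i l = window x (i + k) l"
  by (simp add: window_def shift_by_def algebra_simps)

lemma window_append: "window x i (k + l) = window x i k @ window x (i + int k) l"
  by (rule nth_equalityI) (auto simp: nth_append add.assoc)

lemma window_1 [simp]: "window x i (Suc 0) = [x i]"
  by (simp add: window_def)

lemma sublist_window:
  assumes "sublist v (window x i L)"
  obtains a where "a + length v \<le> L" "v = window x (i + int a) (length v)"
proof -
  obtain p s where ps: "window x i L = p @ v @ s"
    using assms unfolding sublist_def by blast
  have len: "L = length p + length v + length s"
    using arg_cong[OF ps, of length] by simp
  have "window x (i + int (length p)) (length v) = v"
  proof (rule window_eq_nthI)
    fix t assume t: "t < length v"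
    then have "window x i L ! (length p + t) = v ! t"
      unfolding ps by (simp add: nth_append)
    then show "x (i + int (length p) + int t) = v ! t"
      using t len by (simp add: add.assoc)
  qed simp
  then show thesis
    using that[of "length p"] len by simp
qed

lemma window_sublist:
  assumes "a + l \<le> L"
  shows "sublist (window x (i + int a) l) (window x i L)"
proof -
  have "L = a + (l + (L - a - l))" using assms by simp
  then have "window x i L = window x i a @ window x (i + int a) l @ window x (i + int a + int l) (L - a - l)"
    by (metis window_append)
  then show ?thesis unfolding sublist_def by blast
qed

section \<open>Orbit closures\<close>

text \<open>This is the orbit closure of \<open>x\<close>, see \<open>closure_shift_orbit\<close> below. Describing it by windows turns
every argument about minimality into one about occurrences of words.\<close>

definition orbit_hull :: "(int \<Rightarrow> 'a) \<Rightarrow> (int \<Rightarrow> 'a) set" where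
  "orbit_hull x = {z. \<forall>i l. \<exists>j. window z i l = window x j l}"

lemma orbit_hullD:
  assumes "z \<in> orbit_hull x" obtains j where "window z i l = window x j l"
  using assms unfolding orbit_hull_def by blast

lemma shift_by_orbit_hull: "z \<in> orbit_hull x \<Longrightarrow> shift_by k z \<in> orbit_hull x"
  by (simp add: orbit_hull_def)

lemma self_in_orbit_hull: "x \<in> orbit_hull x"
  by (auto simp: orbit_hull_def)

lemma orbit_hull_trans: "z \<in> orbit_hull y \<Longrightarrow> y \<in> orbit_hull x \<Longrightarrow> z \<in> orbit_hull x"
  unfolding orbit_hull_def mem_Collect_eq by metis

lemma language_orbit_hull: "language l (orbit_hull x) = range (\<lambda>j. window x j l)"
proof
  show "language l (orbit_hull x) \<subseteq> range (\<lambda>j. window x j l)"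
  proof
    fix w assume "w \<in> language l (orbit_hull x)"
    then obtain z i where z: "w = window z i l" "z \<in> orbit_hull x"
      unfolding language_def by blast
    obtain j where "window z i l = window x j l" using z(2) by (rule orbit_hullD)
    then show "w \<in> range (\<lambda>j. window x j l)" using z by simp
  qed
qed (use self_in_orbit_hull[of x] in \<open>auto simp: language_def\<close>)

lemma open_window:
  fixes W :: "int list set"
  shows "open {z. window z i l \<in> W}"
proof -
  have cyl: "open {z. window z i l = w}" for w :: "int list"
  proof (cases "length w = l")
    case True
    have "window z i l = w \<longleftrightarrow> (\<forall>t<l. z (i + int t) = w ! t)" for z
      using True by (metis nth_window window_eq_nthI)
    then have "{z. window z i l = w} = (\<Inter>t<l. (\<lambda>z. z (i + int t)) -` {w ! t})" by auto
    moreover have "open ((\<lambda>z::int \<Rightarrow> int. z (i + int t)) -` {w ! t})" for t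
      by (rule open_vimage) (auto simp: open_discrete intro: continuous_on_product_coordinates)
    ultimately show ?thesis by auto
  next
    case False
    then have "{z. window z i l = w} = {}" by auto
    then show ?thesis by simp
  qed
  have "{z. window z i l \<in> W} = (\<Union>w\<in>W. {z. window z i l = w})" by auto
  then show ?thesis using cyl by auto
qed

lemma closed_window:
  fixes W :: "int list set"
  shows "closed {z. window z i l \<in> W}"
  using open_window[of i l "- W"] by (simp add: closed_def Collect_neg_eq[symmetric])

lemma closed_orbit_hull:
  fixes x :: "int \<Rightarrow> int"
  shows "closed (orbit_hull x)"
proof -
  have "orbit_hull x = (\<Inter>i. \<Inter>l. {z. window z i l \<in> range (\<lambda>j. window x j l)})"
    by (simp add: orbit_hull_def image_iff set_eq_iff)
  then show ?thesis using closed_window by (simp add: closed_INT)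
qed

lemma closure_shift_orbit:
  fixes x :: "int \<Rightarrow> int"
  shows "closure (shift_orbit x) = orbit_hull x"
proof
  show "closure (shift_orbit x) \<subseteq> orbit_hull x"
    by (rule closure_minimal)
      (auto simp: shift_orbit_def closed_orbit_hull intro: shift_by_orbit_hull self_in_orbit_hull)
  show "orbit_hull x \<subseteq> closure (shift_orbit x)"
  proof
    fix z assume "z \<in> orbit_hull x"
    then have "\<forall>n. \<exists>j. window z (- int n) (2 * n + 1) = window x j (2 * n + 1)"
      by (simp add: orbit_hull_def)
    then obtain j where j: "\<And>n. window z (- int n) (2 * n + 1) = window x (j n) (2 * n + 1)"
      by metis
    define f where "f n = shift_by (j n + int n) x" for n
    have f: "f n i = z i" if "\<bar>i\<bar> \<le> int n" for n i
    proof -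
      have "nat (i + int n) < 2 * n + 1" "0 \<le> i + int n" using that by linarith+
      then show ?thesis
        using window_eqD[OF j, of "nat (i + int n)" n]
        by (simp add: f_def shift_by_def algebra_simps)
    qed
    have "(\<lambda>n. f n i) \<longlonglongrightarrow> z i" for i
      by (rule tendsto_eventually)
        (auto intro!: f eventually_sequentiallyI[of "nat \<bar>i\<bar>"])
    then have "limitin (product_topology (\<lambda>_. euclidean) UNIV) f z sequentially"
      by (auto simp: limitin_componentwise)
    then have "f \<longlonglongrightarrow> z"
      by (simp add: euclidean_product_topology)
    moreover have "f n \<in> closure (shift_orbit x)" for n
      using closure_subset[of "shift_orbit x"] by (auto simp: f_def shift_orbit_def)
    ultimately show "z \<in> closure (shift_orbit x)"
      using closed_sequentially[OF closed_closure] by blast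
  qed
qed

lemma orbit_hull_subshift:
  fixes x :: "int \<Rightarrow> int"
  assumes "finite (range x)"
  shows "orbit_hull x \<in> subshifts"
proof -
  have "shift ` orbit_hull x = orbit_hull x"
  proof
    show "shift ` orbit_hull x \<subseteq> orbit_hull x" by (auto intro: shift_by_orbit_hull)
    show "orbit_hull x \<subseteq> shift ` orbit_hull x"
    proof
      fix z assume "z \<in> orbit_hull x"
      moreover have "z = shift (shift_by (- 1) z)" by (simp add: shift_by_def)
      ultimately show "z \<in> shift ` orbit_hull x" by (metis imageI shift_by_orbit_hull)
    qed
  qed
  moreover have "orbit_hull x \<subseteq> full_shift (range x)"
  proof (clarsimp simp: full_shift_def)
    fix z i assume "z \<in> orbit_hull x"
    then obtain j where "window z i (Suc 0) = window x j (Suc 0)" by (rule orbit_hullD)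
    then show "z i \<in> range x" by simp
  qed
  ultimately show ?thesis
    using closed_orbit_hull assms by (auto simp: subshifts_def)
qed

section \<open>Minimality and uniform recurrence\<close>

definition uniformly_recurrent :: "(int \<Rightarrow> 'a) \<Rightarrow> bool" where
  "uniformly_recurrent x \<longleftrightarrow>
     (\<forall>i l. \<exists>R. \<forall>k. \<exists>j. k \<le> j \<and> j \<le> k + int R \<and> window x j l = window x i l)"

lemma uniformly_recurrentD:
  assumes "uniformly_recurrent x"
  obtains R where "\<And>k. \<exists>j. k \<le> j \<and> j \<le> k + int R \<and> window x j l = window x i l"
  using assms[unfolded uniformly_recurrent_def, rule_format, of l i] that by blast

lemma minimal_subshift_orbit_hull:
  assumes "X \<in> infinite_minimal_subshifts" "x \<in> X"
  shows "orbit_hull x = X"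
  using assms by (simp add: infinite_minimal_subshifts_def closure_shift_orbit)

text \<open>Every window of \<open>x\<close> reappears inside each long enough window of \<open>x\<close>, hence inside each long
enough window of any \<open>z\<close> in the orbit closure. So \<open>x\<close> lies in the orbit closure of \<open>z\<close>.\<close>

lemma uniformly_recurrent_minimal:
  fixes x :: "int \<Rightarrow> int"
  assumes "uniformly_recurrent x" "finite (range x)" "infinite (orbit_hull x)"
  shows "orbit_hull x \<in> infinite_minimal_subshifts"
proof -
  have "orbit_hull z = orbit_hull x" if z: "z \<in> orbit_hull x" for z
  proof -
    have "x \<in> orbit_hull z"
      unfolding orbit_hull_def
    proof (intro CollectI allI)
      fix i l
      obtain R where R: "\<And>k. \<exists>j. k \<le> j \<and> j \<le> k + int R \<and> window x j l = window x i l"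
        using uniformly_recurrentD[OF assms(1), of l i] by blast
      obtain k where k: "window z 0 (R + l) = window x k (R + l)"
        using z by (rule orbit_hullD)
      obtain j where j: "k \<le> j" "j \<le> k + int R" "window x j l = window x i l"
        using R by blast
      have "window z (0 + int (nat (j - k))) l = window x (k + int (nat (j - k))) l"
        using j by (intro window_eq_sub[OF k]) linarith
      then show "\<exists>j. window x i l = window z j l"
        using j by (intro exI[of _ "int (nat (j - k))"]) simp
    qed
    then show ?thesis using z orbit_hull_trans by blast
  qed
  then show ?thesis
    using assms orbit_hull_subshift
    by (simp add: infinite_minimal_subshifts_def closure_shift_orbit)
qed

lemma subshift_compact:
  assumes "X \<in> subshifts" shows "compact X"
proof -
  obtain A where A: "finite A" "X \<subseteq> full_shift A" "closed X"
    using assms unfolding subshifts_def by blast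
  have "compactin (product_topology (\<lambda>_. euclidean) UNIV) (PiE UNIV (\<lambda>_::int. A))"
    using A(1) by (simp add: compactin_PiE finite_imp_compact)
  moreover have "PiE UNIV (\<lambda>_::int. A) = full_shift A"
    by (auto simp: full_shift_def PiE_def Pi_def extensional_def)
  ultimately have "compact (full_shift A)"
    by (simp add: euclidean_product_topology)
  then show ?thesis
    using A by (metis compact_Int_closed inf.absorb_iff2)
qed

text \<open>Minimality says that the open cylinders of one word, taken at all positions, cover \<open>X\<close>. A finite
subcover bounds the gaps between occurrences of that word.\<close>

lemma minimal_uniformly_recurrent:
  assumes X: "X \<in> infinite_minimal_subshifts" and x: "x \<in> X"
  shows "uniformly_recurrent x"
  unfolding uniformly_recurrent_def
proof (intro allI)
  fix i l
  define w where "w = window x i l"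
  have sub: "X \<in> subshifts" using X by (simp add: infinite_minimal_subshifts_def)
  have "X \<subseteq> (\<Union>k. {z. window z k l \<in> {w}})"
  proof
    fix z assume "z \<in> X"
    then have "x \<in> orbit_hull z" using minimal_subshift_orbit_hull[OF X] x by simp
    then obtain k where "window x i l = window z k l" by (rule orbit_hullD)
    then show "z \<in> (\<Union>k. {z. window z k l \<in> {w}})" by (auto simp: w_def)
  qed
  then obtain K where K: "finite K" "X \<subseteq> (\<Union>k\<in>K. {z. window z k l \<in> {w}})"
    using compactE_image[OF subshift_compact[OF sub], of UNIV "\<lambda>k. {z. window z k l \<in> {w}}"]
      open_window by metis
  obtain B where B: "\<And>k. k \<in> K \<Longrightarrow> \<bar>k\<bar> \<le> int B"
  proof -
    have "\<bar>k\<bar> \<le> int (nat (\<Sum>k\<in>K. \<bar>k\<bar>))" if "k \<in> K" for k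
      using member_le_sum[of k K abs] that K(1) by simp
    then show thesis using that by blast
  qed
  show "\<exists>R. \<forall>k. \<exists>j. k \<le> j \<and> j \<le> k + int R \<and> window x j l = window x i l"
  proof (intro exI[of _ "2 * B"] allI)
    fix k
    have "shift_by (k + int B) x \<in> X" using shift_by_subshift[OF sub x] .
    then obtain k' where k': "k' \<in> K" "window x (k' + (k + int B)) l = w"
      using K(2) by auto
    then show "\<exists>j. k \<le> j \<and> j \<le> k + int (2 * B) \<and> window x j l = window x i l"
      using B[OF k'(1)] by (intro exI[of _ "k' + (k + int B)"]) (auto simp: w_def)
  qed
qed

text \<open>A point that is periodic from \<open>0\<close> onwards has a fully periodic point in its orbit closure. The orbit
of the latter is finite and hence closed, so by minimality it is all of \<open>X\<close>.\<close>

lemma minimal_not_eventually_periodic: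
  assumes X: "X \<in> infinite_minimal_subshifts" and x: "x \<in> X" and p: "0 < p"
  shows "\<exists>t. x (int t) \<noteq> x (int (t mod p))"
proof (rule ccontr)
  assume "\<nexists>t. x (int t) \<noteq> x (int (t mod p))"
  then have per: "x (int t) = x (int (t mod p))" for t by blast
  \<comment> \<open>The periodic extension of the right half of \<open>x\<close>: all its windows occur in that half.\<close>
  define z where "z i = x (i mod int p)" for i
  have "z \<in> orbit_hull x"
    unfolding orbit_hull_def
  proof (intro CollectI allI exI)
    fix i l
    show "window z i l = window x (i mod int p) l"
    proof (rule window_eqI)
      fix t
      define s where "s = nat (i mod int p) + t"
      have s: "int s = i mod int p + int t" using p by (simp add: s_def)
      have "int (s mod p) = (i + int t) mod int p"
        by (simp add: zmod_int s mod_add_left_eq)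
      then show "z (i + int t) = x (i mod int p + int t)"
        using per[of s] s by (simp add: z_def)
    qed
  qed
  then have hull: "orbit_hull z = X"
    using minimal_subshift_orbit_hull[OF X] x by simp
  have "shift_by k z = shift_by (k mod int p) z" for k
    by (simp add: shift_by_def z_def mod_add_right_eq)
  then have "shift_orbit z \<subseteq> (\<lambda>k. shift_by k z) ` {0..<int p}"
    using p unfolding shift_orbit_def
    by (intro image_subsetI) (rule_tac x = "x mod int p" in image_eqI, auto)
  then have fin: "finite (shift_orbit z)" using finite_surj by blast
  have "closed {g}" for g :: "int \<Rightarrow> int"
  proof -
    have "closed (\<Inter>i. {f. window f i 1 \<in> {[g i]}})"
      by (intro closed_INT ballI closed_window)
    moreover have "(\<Inter>i. {f. window f i 1 \<in> {[g i]}}) = {g}" by auto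
    ultimately show ?thesis by simp
  qed
  then have "closed (\<Union>g\<in>shift_orbit z. {g})" by (intro closed_UN fin) simp
  then have "closed (shift_orbit z)" by simp
  then have "X = shift_orbit z"
    using closure_shift_orbit[of z] hull by simp
  then show False using X fin by (simp add: infinite_minimal_subshifts_def)
qed

section \<open>Directive sequences read off from a tower of block codings\<close>

text \<open>The sequence \<open>y (Suc n)\<close> is obtained from \<open>y n\<close> by cutting \<open>y n\<close> into blocks of length \<open>r n\<close>, the
block with index \<open>0\<close> starting at position \<open>s n\<close>, and replacing each block by a letter that determines
it. The offset \<open>s n\<close> is there because the
cuts of one fixed point must be respected at all levels at once; moving the point instead would
require a limit. The assumption \<open>phase\<close> says that the position of a cut modulo \<open>r n\<close> can be read off a
window of bounded length, and it yields recognizability; \<open>same_hd\<close> and \<open>same_last\<close> compare the letters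
on either side of the cuts and yield properness; together with \<open>phase\<close>, uniform recurrence of \<open>y 0\<close>
passes to all levels and yields primitivity.\<close>

locale block_tower =
  fixes y :: "nat \<Rightarrow> int \<Rightarrow> int" and r :: "nat \<Rightarrow> nat" and s :: "nat \<Rightarrow> int"
  assumes finite_alphabet: "finite (range (y n))"
    and ratio_ge_2: "2 \<le> r n"
    and coding: "y (Suc n) i = y (Suc n) j \<longleftrightarrow>
      window (y n) (s n + i * int (r n)) (r n) = window (y n) (s n + j * int (r n)) (r n)"
    and phase: "\<exists>L. \<forall>i j. window (y n) i L = window (y n) j L \<longrightarrow> int (r n) dvd i - j"
    and same_hd: "y n (s n + i * int (r n)) = y n (s n + j * int (r n))"
    and same_last: "y n (s n + i * int (r n) - 1) = y n (s n + j * int (r n) - 1)"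
    and recurrent_0: "uniformly_recurrent (y 0)"
begin

definition occurrence :: "nat \<Rightarrow> int \<Rightarrow> int" where
  "occurrence n a = (SOME i. y n i = a)"

text \<open>Every occurrence of the letter gives the same block, by the assumption \<open>coding\<close>.\<close>

definition block :: "nat \<Rightarrow> int \<Rightarrow> int list" where
  "block n a = window (y n) (s n + occurrence (Suc n) a * int (r n)) (r n)"

definition subst :: "nat \<Rightarrow> int list \<Rightarrow> int list" where
  "subst n u = concat (map (block n) u)"

definition alphabet :: "nat \<Rightarrow> int set" where
  "alphabet n = range (y n)"

lemma ratio_pos: "0 < r n"
  using ratio_ge_2[of n] by simp

lemma length_block [simp]: "length (block n a) = r n"
  by (simp add: block_def)

lemma subst_single [simp]: "subst n [a] = block n a"
  by (simp add: subst_def)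

lemma block_y: "block n (y (Suc n) i) = window (y n) (s n + i * int (r n)) (r n)"
proof -
  have "y (Suc n) (occurrence (Suc n) (y (Suc n) i)) = y (Suc n) i"
    unfolding occurrence_def by (rule someI) (rule refl)
  then show ?thesis by (simp add: block_def coding)
qed

lemma block_inj:
  assumes "a \<in> alphabet (Suc n)" "b \<in> alphabet (Suc n)" "block n a = block n b"
  shows "a = b"
  using assms coding by (auto simp: alphabet_def block_y)

lemma concat_windows:
  assumes "\<And>i. f (z i) = window x (q + i * int l) l"
  shows "concat (map f (window z i k)) = window x (q + i * int l) (k * l)"
proof (induction k arbitrary: i)
  case 0
  then show ?case by (simp add: window_def)
next
  case (Suc k)
  have "window z i (Suc k) = z i # window z (i + 1) k"
    using window_append[of z i 1 k] by simp
  then show ?case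
    using Suc[of "i + 1"] window_append[of x "q + i * int l" l "k * l"] assms[of i]
    by (simp add: algebra_simps)
qed

lemma subst_window:
  "subst n (window (y (Suc n)) i l) = window (y n) (s n + i * int (r n)) (l * r n)"
  unfolding subst_def by (rule concat_windows) (rule block_y)

definition height :: "nat \<Rightarrow> nat \<Rightarrow> nat" where
  "height n N = (\<Prod>k\<in>{n..<N}. r k)"

lemma compose_range_Suc:
  "n < N \<Longrightarrow> compose_range \<tau> n N = \<tau> n \<circ> compose_range \<tau> (Suc n) N"
  by (simp add: compose_range_def upt_conv_Cons)

text \<open>Iterating \<open>subst_window\<close>: every composition maps windows of \<open>y N\<close> to windows of \<open>y n\<close> that are aligned
with the cuts of level \<open>N\<close>. The offset \<open>S\<close> accumulates the offsets \<open>s n, \<dots>, s (N - 1)\<close>.\<close>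

lemma compose_window:
  assumes "n \<le> N"
  shows "\<exists>S. \<forall>i l. compose_range subst n N (window (y N) i l)
           = window (y n) (S + i * int (height n N)) (l * height n N)"
  using assms
proof (induction rule: inc_induct)
  case base
  show ?case by (intro exI[of _ 0]) (simp add: compose_range_def height_def)
next
  case (step n)
  then obtain S where S: "\<And>i l. compose_range subst (Suc n) N (window (y N) i l)
           = window (y (Suc n)) (S + i * int (height (Suc n) N)) (l * height (Suc n) N)" by blast
  have h: "height n N = r n * height (Suc n) N"
    using step by (simp add: height_def prod.atLeast_Suc_lessThan)
  show ?case
    using step
    by (intro exI[of _ "s n + S * int (r n)"])
      (simp add: compose_range_Suc S subst_window h algebra_simps)
qed

lemma compose_letter:
  assumes "n \<le> N"
  obtains S where "\<And>i. compose_range subst n N [y N i]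
           = window (y n) (S + i * int (height n N)) (height n N)"
proof -
  obtain S where S: "\<And>i l. compose_range subst n N (window (y N) i l)
           = window (y n) (S + i * int (height n N)) (l * height n N)"
    using compose_window[OF assms] by blast
  show thesis using that[of S] S[of _ 1] by simp
qed

lemma height_ge: "N - n \<le> height n N"
proof (cases "n \<le> N")
  case True
  have "2 ^ (N - n) = (\<Prod>k\<in>{n..<N}. 2::nat)" by simp
  also have "\<dots> \<le> height n N"
    unfolding height_def by (rule prod_mono) (simp add: ratio_ge_2)
  finally have "2 ^ (N - n) \<le> height n N" .
  moreover have "N - n < 2 ^ (N - n)" by (rule less_exp)
  ultimately show ?thesis by linarith
qed simp

text \<open>A window of \<open>y (Suc n)\<close> is a window of \<open>y n\<close> that starts at a cut. Enlarging the latter by \<open>L\<close> letters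
pins down its phase, so that all its occurrences start at cuts and therefore decode to occurrences of
the original window of \<open>y (Suc n)\<close>.\<close>

lemma recurrent: "uniformly_recurrent (y n)"
proof (induction n)
  case 0
  show ?case by (rule recurrent_0)
next
  case (Suc n)
  show ?case
    unfolding uniformly_recurrent_def
  proof (intro allI)
    fix i l
    obtain L where L: "\<And>i j. window (y n) i L = window (y n) j L \<Longrightarrow> int (r n) dvd i - j"
      using phase by blast
    define p where "p = s n + i * int (r n)"
    obtain R where R: "\<And>k. \<exists>j. k \<le> j \<and> j \<le> k + int R \<and>
        window (y n) j (l * r n + L) = window (y n) p (l * r n + L)"
      using uniformly_recurrentD[OF Suc, of "l * r n + L" p] by blast
    show "\<exists>R. \<forall>k. \<exists>j. k \<le> j \<and> j \<le> k + int R \<and> window (y (Suc n)) j l = window (y (Suc n)) i l"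
    proof (intro exI[of _ R] allI)
      fix k
      obtain j where j: "s n + k * int (r n) \<le> j" "j \<le> s n + k * int (r n) + int R"
        "window (y n) j (l * r n + L) = window (y n) p (l * r n + L)"
        using R by blast
      have "int (r n) dvd j - p"
        using window_eq_sub[OF j(3), of 0 L] L by simp
      then obtain d where d: "j - p = int (r n) * d" by (rule dvdE)
      define i' where "i' = i + d"
      have i': "j = s n + i' * int (r n)"
        using d by (simp add: i'_def p_def algebra_simps)
      have "window (y (Suc n)) i' l = window (y (Suc n)) i l"
      proof (rule window_eqI)
        fix t assume t: "t < l"
        have "t * r n + r n \<le> l * r n + L"
          using mult_le_mono1[of "Suc t" l "r n"] t by simp
        from window_eq_sub[OF j(3) this]
        show "y (Suc n) (i' + int t) = y (Suc n) (i + int t)"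
          by (simp add: coding i' p_def algebra_simps)
      qed
      moreover have "k * int (r n) \<le> i' * int (r n)" using j(1) i' by simp
      then have "k \<le> i'" using ratio_pos[of n] by simp
      moreover have "(i' - k) * 1 \<le> (i' - k) * int (r n)"
        using \<open>k \<le> i'\<close> ratio_pos[of n] by (intro mult_left_mono) auto
      then have "i' \<le> k + int R" using j(2) i' by (simp add: algebra_simps)
      ultimately show "\<exists>j. k \<le> j \<and> j \<le> k + int R \<and> window (y (Suc n)) j l = window (y (Suc n)) i l"
        by blast
    qed
  qed
qed

lemma directive: "directive_sequence alphabet subst"
proof -
  have block_in: "set (block n a) \<subseteq> alphabet n" for n a
    by (auto simp: block_def window_def alphabet_def)
  have "morphism (alphabet (Suc n)) (alphabet n) (subst n)" for n
    using block_in[of n] ratio_pos[of n]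
    by (force simp: morphism_def subst_def simp flip: length_greater_0_conv)
  then show ?thesis
    by (simp add: directive_sequence_def finite_alphabet alphabet_def)
qed

lemma constant_length: "constant_length alphabet subst"
  by (simp add: constant_length_def)

lemma proper: "proper alphabet subst"
proof -
  have "hd (block n (y (Suc n) i)) = hd (block n (y (Suc n) j))" for n i j
    using ratio_pos[of n] same_hd[of n i j] by (simp add: block_y hd_conv_nth flip: length_greater_0_conv)
  moreover have "last (block n (y (Suc n) i)) = y n (s n + (i + 1) * int (r n) - 1)" for n i
    using ratio_pos[of n]
    by (simp add: block_y last_conv_nth algebra_simps of_nat_diff flip: length_greater_0_conv)
  ultimately show ?thesis
    using same_last by (auto simp: proper_def alphabet_def)
qed

lemma primitive: "primitive alphabet subst"
  unfolding primitive_def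
proof
  fix n
  have "\<exists>R. \<forall>k. \<exists>j. k \<le> j \<and> j \<le> k + int R \<and> y n j = a" if a: "a \<in> alphabet n" for a
  proof -
    obtain i where "y n i = a" using a by (auto simp: alphabet_def)
    moreover obtain R where "\<And>k. \<exists>j. k \<le> j \<and> j \<le> k + int R \<and> window (y n) j (Suc 0) = window (y n) i (Suc 0)"
      using uniformly_recurrentD[OF recurrent[of n], of "Suc 0" i] by blast
    ultimately show ?thesis by auto
  qed
  then obtain f where f: "\<And>a k. a \<in> alphabet n \<Longrightarrow> \<exists>j. k \<le> j \<and> j \<le> k + int (f a) \<and> y n j = a"
    by metis
  define R where "R = Max (f ` alphabet n)"
  have R: "f a \<le> R" if "a \<in> alphabet n" for a
    using that finite_alphabet[of n] by (simp add: R_def alphabet_def)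
  define N where "N = n + R + 1"
  have "alphabet n \<subseteq> set (compose_range subst n N [b])" if b: "b \<in> alphabet N" for b
  proof
    fix a assume a: "a \<in> alphabet n"
    obtain i where i: "b = y N i" using b by (auto simp: alphabet_def)
    obtain S where S: "compose_range subst n N [y N i]
        = window (y n) (S + i * int (height n N)) (height n N)"
      using compose_letter[of n N] by (auto simp: N_def)
    define k where "k = S + i * int (height n N)"
    obtain j where j: "k \<le> j" "j \<le> k + int (f a)" "y n j = a" using f[OF a] by blast
    have "nat (j - k) < height n N"
      using j R[OF a] height_ge[of N n] by (simp add: N_def)
    moreover have "k + int (nat (j - k)) = j" using j by simp
    ultimately have "a \<in> set (window (y n) k (height n N))"
      using j(3) by (force simp: window_def)
    then show "a \<in> set (compose_range subst n N [b])" using S i by (simp add: k_def)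
  qed
  then show "\<exists>N>n. \<forall>a\<in>alphabet N. alphabet n \<subseteq> set (compose_range subst n N [a])"
    by (intro exI[of _ N]) (simp add: N_def)
qed

text \<open>A word in the image of a letter \<open>y N k\<close> is by \<open>compose_letter\<close> part of a window of \<open>y n\<close>.\<close>

lemma sadic_level_subset: "sadic_level alphabet subst n \<subseteq> orbit_hull (y n)"
proof
  fix z assume z: "z \<in> sadic_level alphabet subst n"
  show "z \<in> orbit_hull (y n)"
    unfolding orbit_hull_def
  proof (intro CollectI allI)
    fix i l
    obtain N a where N: "N > n" "a \<in> alphabet N" "sublist (window z i l) (compose_range subst n N [a])"
      using z unfolding sadic_level_def by blast
    obtain k where k: "a = y N k" using N(2) by (auto simp: alphabet_def)
    obtain S where "compose_range subst n N [a]
        = window (y n) (S + k * int (height n N)) (height n N)"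
      using compose_letter[of n N] N(1) k by auto
    then show "\<exists>j. window z i l = window (y n) j l"
      using N(3) by (metis length_window sublist_window)
  qed
qed

text \<open>The inclusion not covered by \<open>sadic_level_subset\<close> uses uniform recurrence: an image of a letter of a
high level is a window of \<open>y 0\<close> so long that every given window of \<open>y 0\<close> occurs in it.\<close>

lemma sadic_subshift_eq: "sadic_subshift alphabet subst = orbit_hull (y 0)"
  unfolding sadic_subshift_def
proof
  show "sadic_level alphabet subst 0 \<subseteq> orbit_hull (y 0)" by (rule sadic_level_subset)
  show "orbit_hull (y 0) \<subseteq> sadic_level alphabet subst 0"
  proof
    fix z assume z: "z \<in> orbit_hull (y 0)"
    have "z i \<in> alphabet 0" for i
    proof -
      obtain j where "window z i (Suc 0) = window (y 0) j (Suc 0)" using z by (rule orbit_hullD)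
      then show ?thesis by (simp add: alphabet_def)
    qed
    moreover have "\<exists>N>0. \<exists>a\<in>alphabet N. sublist (window z i l) (compose_range subst 0 N [a])" for i l
    proof -
      obtain p where p: "window z i l = window (y 0) p l" using z by (rule orbit_hullD)
      obtain R where R: "\<And>k. \<exists>j. k \<le> j \<and> j \<le> k + int R \<and> window (y 0) j l = window (y 0) p l"
        using uniformly_recurrentD[OF recurrent_0, of l p] by blast
      define N where "N = R + l + 1"
      obtain S where S: "compose_range subst 0 N [y N 0] = window (y 0) S (height 0 N)"
        using compose_letter[of 0 N] by (metis add.right_neutral le0 mult_zero_left)
      obtain j where j: "S \<le> j" "j \<le> S + int R" "window (y 0) j l = window (y 0) p l"
        using R by blast
      have "nat (j - S) + l \<le> height 0 N"
        using j height_ge[of N 0] by (simp add: N_def)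
      then have "sublist (window (y 0) (S + int (nat (j - S))) l) (window (y 0) S (height 0 N))"
        by (rule window_sublist)
      then have "sublist (window z i l) (compose_range subst 0 N [y N 0])"
        using S p j by simp
      then show ?thesis by (intro exI[of _ N]) (auto simp: N_def alphabet_def)
    qed
    ultimately show "z \<in> sadic_level alphabet subst 0"
      by (simp add: sadic_level_def full_shift_def)
  qed
qed

lemma apply_subst:
  "window (apply_biinf (subst n) z) (j * int (r n)) (r n) = block n (z j)"
proof (rule window_eq_nthI)
  fix t assume t: "t < r n"
  have "card {0..<j} * r n = nat j * r n" "card {j..<0} * r n = nat (- j) * r n" by simp_all
  then have "block_start (subst n) z j = j * int (r n)"
    by (cases "j \<ge> 0") (simp_all add: block_start_def)
  moreover have "subst n [z i] \<noteq> []" for i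
    using ratio_pos[of n] by (simp flip: length_greater_0_conv)
  ultimately show "apply_biinf (subst n) z (j * int (r n) + int t) = block n (z j) ! t"
    using apply_biinf_block[of "subst n" z t j] t by simp
qed simp

lemma apply_subst_window:
  assumes "z \<in> orbit_hull (y (Suc n))"
  shows "\<exists>j. window (apply_biinf (subst n) z) 0 (l * r n)
            = window (y n) (s n + j * int (r n)) (l * r n)"
proof -
  obtain j where j: "window z 0 l = window (y (Suc n)) j l" using assms by (rule orbit_hullD)
  have "window (apply_biinf (subst n) z) (0 + 0 * int (r n)) (l * r n) = concat (map (block n) (window z 0 l))"
    by (rule concat_windows[symmetric]) (simp add: apply_subst)
  also have "\<dots> = window (y n) (s n + j * int (r n)) (l * r n)"
    using subst_window[of n j l] j by (simp add: subst_def)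
  finally show ?thesis by auto
qed

lemma orbit_hull_range: "z \<in> orbit_hull (y n) \<Longrightarrow> z i \<in> alphabet n"
  by (metis alphabet_def list.inject orbit_hullD rangeI window_1)

text \<open>Two representations of the same point put two windows of \<open>y n\<close>, starting \<open>k1\<close> and \<open>k2\<close> places after
cuts, in coincidence. By \<open>phase\<close> this forces \<open>k1 = k2\<close>, and then the blocks and hence the letters
agree one by one.\<close>

lemma recognizable: "recognizable alphabet subst"
  unfolding recognizable_def
proof (intro allI ballI Uniq_I, elim case_prodE, hypsubst, elim conjE)
  fix n z1 k1 z2 k2 
  fix x :: "int \<Rightarrow> int"
  assume z1: "z1 \<in> sadic_level alphabet subst (Suc n)" and z2: "z2 \<in> sadic_level alphabet subst (Suc n)"
    and k1: "0 \<le> k1" "k1 < int (length (subst n [z1 0]))"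
    and k2: "0 \<le> k2" "k2 < int (length (subst n [z2 0]))"
    and x1: "x = shift_by k1 (apply_biinf (subst n) z1)"
    and x2: "x = shift_by k2 (apply_biinf (subst n) z2)"
  let ?f = "apply_biinf (subst n)"
  have eq: "shift_by k1 (?f z1) = shift_by k2 (?f z2)" using x1 x2 by simp
  obtain L where L: "\<And>i j. window (y n) i L = window (y n) j L \<Longrightarrow> int (r n) dvd i - j"
    using phase by blast
  have "\<exists>j. window (?f z) k L = window (y n) (s n + j * int (r n) + k) L"
    if z: "z \<in> sadic_level alphabet subst (Suc n)" and k: "0 \<le> k" "k < int (r n)" for z k
  proof -
    obtain j where j: "window (?f z) 0 ((L + 1) * r n) = window (y n) (s n + j * int (r n)) ((L + 1) * r n)"
      using apply_subst_window[of z n "L + 1"] z sadic_level_subset by blast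
    have "L * 1 \<le> L * r n" using ratio_pos[of n] by (intro mult_left_mono) auto
    moreover have "nat k \<le> r n" using k by simp
    ultimately have "nat k + L * 1 \<le> r n + L * r n" by (rule add_mono[rotated])
    then have "nat k + L \<le> (L + 1) * r n" by simp
    from window_eq_sub[OF j this] show ?thesis using k by auto
  qed
  then obtain j1 j2 where
    "window (?f z1) k1 L = window (y n) (s n + j1 * int (r n) + k1) L"
    "window (?f z2) k2 L = window (y n) (s n + j2 * int (r n) + k2) L"
    using z1 z2 k1 k2 by (metis length_block subst_single)
  moreover have "window (?f z1) k1 L = window (?f z2) k2 L"
    using arg_cong[OF eq, of "\<lambda>w. window w 0 L"] by simp
  ultimately have "int (r n) dvd (s n + j1 * int (r n) + k1) - (s n + j2 * int (r n) + k2)"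
    by (intro L) simp
  moreover have "(s n + j1 * int (r n) + k1) - (s n + j2 * int (r n) + k2) = (j1 - j2) * int (r n) + (k1 - k2)"
    by (simp add: algebra_simps)
  ultimately have "int (r n) dvd k1 - k2"
    by (metis dvd_add_right_iff dvd_triv_right)
  then have k: "k1 = k2"
    using k1 k2 by (simp add: mod_eq_dvd_iff[symmetric])
  have f: "?f z1 = ?f z2"
  proof
    fix i show "?f z1 i = ?f z2 i"
      using fun_cong[OF eq, of "i - k2"] k by (simp add: shift_by_def)
  qed
  have "z1 i = z2 i" for i
  proof (rule block_inj)
    show "z1 i \<in> alphabet (Suc n)" "z2 i \<in> alphabet (Suc n)"
      using z1 z2 sadic_level_subset orbit_hull_range by blast+
    show "block n (z1 i) = block n (z2 i)"
      using apply_subst[of n _ i] f by metis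
  qed
  then have "z1 = z2" by blast
  then show "(z1, k1) = (z2, k2)" using k by simp
qed

theorem strong_Toeplitz:
  assumes "\<And>n. card (alphabet (Suc n)) \<le> K"
  shows "strong_Toeplitz_rank K (orbit_hull (y 0))"
proof -
  have "\<forall>\<^sub>F n in sequentially. enat (card (alphabet n)) \<le> enat K"
    by (rule eventually_sequentiallyI[of 1]) (metis One_nat_def Suc_le_D assms enat_ord_simps(1))
  then have "alphabet_rank alphabet \<le> enat K"
    unfolding alphabet_rank_def by (intro Liminf_le) auto
  moreover have "conjugate_subshifts (orbit_hull (y 0)) (sadic_subshift alphabet subst)"
    unfolding sadic_subshift_eq conjugate_subshifts_def
    by (intro exI[of _ id]) (auto simp: homeomorphism_def)
  ultimately show ?thesis
    unfolding strong_Toeplitz_rank_def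
    using directive constant_length primitive proper recognizable orbit_hull_subshift[OF finite_alphabet]
    by blast
qed

end

section \<open>Subshifts tiled by two words\<close>

text \<open>Uniqueness is required in only one interval, but \<open>X\<close> is shift-invariant in all applications. Then every
interval of \<open>length u\<close> positions contains exactly one start of an occurrence of \<open>u\<close> or \<open>v\<close>, so the
occurrences tile each point (\<open>tiled_by_progression\<close>). Phrasing the tiling in this way makes it a condition on
windows of length \<open>2 * length u\<close> and includes its uniqueness.\<close>

definition tiled_by :: "(int \<Rightarrow> int) set \<Rightarrow> int list \<Rightarrow> int list \<Rightarrow> bool" where
  "tiled_by X u v \<longleftrightarrow>
     (\<forall>x\<in>X. \<exists>!i. 0 \<le> i \<and> i < int (length u) \<and> window x i (length u) \<in> {u, v})"

definition two_block_tilable :: "nat \<Rightarrow> (int \<Rightarrow> int) set \<Rightarrow> bool" where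
  "two_block_tilable m X \<longleftrightarrow>
     (\<exists>u v. length v = length u \<and> 0 < length u \<and> m dvd length u \<and> take m u = take m v \<and> tiled_by X u v)"

text \<open>Comparing the intervals of length \<open>l\<close> that start at \<open>e\<close> and at \<open>e + 1\<close> shows that an element \<open>e\<close> of the
set \<open>P\<close> is followed by \<open>e + l\<close>; similarly it is preceded by \<open>e - l\<close>.\<close>

lemma unique_in_intervals_imp_progression:
  fixes l :: nat
  assumes l: "0 < l" and uniq: "\<And>t. \<exists>!i. t \<le> i \<and> i < t + int l \<and> P i" and k: "P k"
  shows "P i \<longleftrightarrow> int l dvd i - k"
proof -
  have step: "P (e + int l) \<and> P (e - int l)" if e: "P e" for e
  proof
    obtain i where i: "e + 1 \<le> i" "i < e + 1 + int l" "P i" using uniq[of "e + 1"] by blast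
    have "i = e + int l"
    proof (rule ccontr)
      assume "i \<noteq> e + int l"
      then have "e \<le> i \<and> i < e + int l \<and> P i" "e \<le> e \<and> e < e + int l \<and> P e" using i e l by auto
      then show False using uniq[of e] i by (metis zless_add1_eq less_irrefl add1_zle_eq)
    qed
    then show "P (e + int l)" using i by simp
    obtain i where i: "e - int l \<le> i" "i < e" "P i" using uniq[of "e - int l"] by auto
    have "i = e - int l"
    proof (rule ccontr)
      assume "i \<noteq> e - int l"
      then have "e - int l + 1 \<le> i \<and> i < e - int l + 1 + int l \<and> P i"
        "e - int l + 1 \<le> e \<and> e < e - int l + 1 + int l \<and> P e" using i e l by auto
      then show False using uniq[of "e - int l + 1"] i by (metis less_irrefl)
    qed
    then show "P (e - int l)" using i by simp
  qed
  have all: "P (k + int l * d)" for d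
  proof (induction d rule: int_induct[where k = 0])
    case base
    show ?case using k by simp
  next
    case (step1 d)
    then show ?case using step[of "k + int l * d"] by (simp add: algebra_simps)
  next
    case (step2 d)
    then show ?case using step[of "k + int l * d"] by (simp add: algebra_simps)
  qed
  show ?thesis
  proof
    assume P: "P i"
    define t where "t = i - (i - k) mod int l"
    have "k + int l * ((i - k) div int l) = t"
      using minus_mod_eq_mult_div[of "i - k" "int l"] by (simp add: t_def)
    then have "P t" using all[of "(i - k) div int l"] by simp
    moreover have "t \<le> i" "i < t + int l" using l by (simp_all add: t_def)
    ultimately have "t \<le> i \<and> i < t + int l \<and> P i" "t \<le> t \<and> t < t + int l \<and> P t" using P l by auto
    then have "i = t" using uniq[of t] by blast
    then have "(i - k) mod int l = 0" by (simp add: t_def)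
    then show "int l dvd i - k" by (simp add: mod_0_imp_dvd)
  next
    assume "int l dvd i - k"
    then obtain d where "i - k = int l * d" by (rule dvdE)
    then show "P i" using all[of d] by (simp add: algebra_simps)
  qed
qed

lemma tiled_by_progression:
  assumes X: "X \<in> subshifts" and x: "x \<in> X" and tiled: "tiled_by X u v" and u: "0 < length u"
  obtains k where "\<And>i. window x i (length u) \<in> {u, v} \<longleftrightarrow> int (length u) dvd i - k"
proof -
  have uniq: "\<exists>!i. t \<le> i \<and> i < t + int (length u) \<and> window x i (length u) \<in> {u, v}" for t
  proof -
    have "\<exists>!i. 0 \<le> i \<and> i < int (length u) \<and> window (shift_by t x) i (length u) \<in> {u, v}"
      using tiled shift_by_subshift[OF X x, of t] unfolding tiled_by_def by blast
    then obtain i where i: "0 \<le> i" "i < int (length u)" "window x (i + t) (length u) \<in> {u, v}"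
      and un: "\<And>i'. 0 \<le> i' \<Longrightarrow> i' < int (length u) \<Longrightarrow> window x (i' + t) (length u) \<in> {u, v} \<Longrightarrow> i' = i"
      unfolding window_shift_by by blast
    show ?thesis
    proof (rule ex1I[of _ "i + t"])
      fix i' assume "t \<le> i' \<and> i' < t + int (length u) \<and> window x i' (length u) \<in> {u, v}"
      then show "i' = i + t" using un[of "i' - t"] by simp
    qed (use i in auto)
  qed
  obtain k where k: "window x k (length u) \<in> {u, v}" using uniq[of 0] by blast
  show thesis
    using unique_in_intervals_imp_progression[OF u uniq k] that by blast
qed

text \<open>A pair \<open>(l, q)\<close> describes the cutting of \<open>x\<close> at the positions \<open>q + j * l\<close>. The last condition says that
the phase of this cutting is visible in windows of bounded length. Level \<open>0\<close> is the cutting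
into single letters, whose number need not be bounded by \<open>2\<close>.\<close>

definition tower_level :: "(int \<Rightarrow> int) \<Rightarrow> nat \<Rightarrow> nat \<times> int \<Rightarrow> bool" where
  "tower_level x n = (\<lambda>(l, q). 0 < l \<and>
     (if n = 0 then l = 1 \<and> q = 0
      else finite (range (\<lambda>j. window x (q + j * int l) l)) \<and> card (range (\<lambda>j. window x (q + j * int l) l)) \<le> 2) \<and>
     (\<exists>L. \<forall>i j. window x i L = window x j L \<longrightarrow> int l dvd i - j))"

text \<open>The last two conditions say that all cuts of the coarser cutting \<open>(l', q')\<close> are followed by the same
block of the finer one, and preceded by the same block of the finer one.\<close>

definition tower_step :: "(int \<Rightarrow> int) \<Rightarrow> nat \<times> int \<Rightarrow> nat \<times> int \<Rightarrow> bool" where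
  "tower_step x = (\<lambda>(l, q) (l', q'). l dvd l' \<and> 2 * l \<le> l' \<and> int l dvd q' - q \<and>
     (\<forall>i j. window x (q' + i * int l') l = window x (q' + j * int l') l) \<and>
     (\<forall>i j. window x (q' + i * int l' - int l) l = window x (q' + j * int l' - int l) l))"

text \<open>The tiling by \<open>u\<close> and \<open>v\<close> at scale \<open>3 * l\<close> starts at some position \<open>k\<close> that need not be a cut of
\<open>(l, q)\<close>. Moving it to the right by some \<open>c\<close> with \<open>l \<le> c < 2 * l\<close> repairs this. As \<open>u\<close> and \<open>v\<close> share a
prefix of length \<open>3 * l\<close>, the moved tiles still take at most two values, and the \<open>l\<close> letters before and
after every moved cut lie inside copies of that prefix.\<close>

lemma tower_step_exists:
  assumes X: "X \<in> subshifts" and x: "x \<in> X" and tilable: "two_block_tilable (3 * l) X" and l: "0 < l"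
  obtains l' q' where "tower_level x (Suc n) (l', q')" "tower_step x (l, q) (l', q')"
proof -
  obtain u v where uv: "length v = length u" "0 < length u" "3 * l dvd length u"
      "take (3 * l) u = take (3 * l) v" "tiled_by X u v"
    using tilable unfolding two_block_tilable_def by blast
  define l' where "l' = length u"
  obtain k where k: "\<And>i. window x i l' \<in> {u, v} \<longleftrightarrow> int l' dvd i - k"
    using tiled_by_progression[OF X x uv(5,2)] unfolding l'_def by blast
  have len: "length u = l'" "length v = l'" using uv(1) by (simp_all add: l'_def)
  have "3 * l \<le> l'" using uv(2,3) by (simp add: l'_def dvd_imp_le)
  define c where "c = l + nat ((q - k) mod int l)"
  have c: "l \<le> c" "c < 2 * l"
    using l by (simp_all add: c_def nat_less_iff)
  define q' where "q' = k + int c"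
  have common: "u ! t = v ! t" if "t < 3 * l" for t
    using that uv(4) by (metis nth_take)
  have tile: "window x (k + j * int l') l' \<in> {u, v}" for j using k by simp
  have prefix: "x (k + j * int l' + int t) = u ! t" if t: "t < 3 * l" for j t
    using tile[of j] common[OF t] nth_window[of t l' x "k + j * int l'"] t \<open>3 * l \<le> l'\<close> by auto
  \<comment> \<open>A moved tile consists of the end of one tile and of the first \<open>c\<close> letters of the next one,
    and the latter do not depend on that tile.\<close>
  have blocks: "window x (q' + j * int l') l' \<in> {drop c u @ take c u, drop c v @ take c u}" for j
  proof -
    obtain w where w: "w \<in> {u, v}" "window x (k + j * int l') l' = w" using tile by blast
    have "window x (q' + j * int l') l' = drop c w @ take c u"
    proof (rule window_eq_nthI)
      show lw: "length (drop c w @ take c u) = l'"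
        using w len c \<open>3 * l \<le> l'\<close> by auto
      fix t assume t: "t < l'"
      show "x (q' + j * int l' + int t) = (drop c w @ take c u) ! t"
      proof (cases "c + t < l'")
        case True
        then have "x (k + j * int l' + int (c + t)) = w ! (c + t)"
          using nth_window[of "c + t" l' x "k + j * int l'"] w(2) by simp
        then show ?thesis using True w len c by (auto simp: q'_def nth_append algebra_simps)
      next
        case False
        define t' where "t' = c + t - l'"
        have t': "c + t = l' + t'" "t' < c" using False t by (simp_all add: t'_def)
        have "q' + j * int l' + int t = k + j * int l' + int (c + t)" by (simp add: q'_def)
        also have "\<dots> = k + (j + 1) * int l' + int t'" by (simp add: t' algebra_simps)
        finally have "x (q' + j * int l' + int t) = u ! t'"
          using prefix[of t' "j + 1"] t' c by simp
        moreover have "length w = l'" using w len by auto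
        moreover have "t - (l' - c) = t'" using t' c \<open>3 * l \<le> l'\<close> by simp
        moreover have "\<not> t < l' - c" using False by simp
        ultimately show ?thesis using t'(2) by (simp add: nth_append)
      qed
    qed
    then show ?thesis using w(1) by auto
  qed
  have "tower_level x (Suc n) (l', q')"
  proof -
    have sub: "range (\<lambda>j. window x (q' + j * int l') l') \<subseteq> {drop c u @ take c u, drop c v @ take c u}"
      using blocks by blast
    have "card (range (\<lambda>j. window x (q' + j * int l') l')) \<le> 2"
      using card_mono[OF _ sub] card_insert_le_m1[of 2 "{drop c v @ take c u}" "drop c u @ take c u"] by simp
    moreover have "finite (range (\<lambda>j. window x (q' + j * int l') l'))"
      using sub by (rule finite_subset) simp
    moreover have "int l' dvd i - j" if eq: "window x i (2 * l') = window x j (2 * l')" for i j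
    proof -
      define a where "a = nat ((k - i) mod int l')"
      have a: "a < l'" "int l' dvd i + int a - k"
      proof -
        show "a < l'" using uv(2) by (simp add: a_def l'_def nat_less_iff)
        have "i + int a - k = - ((k - i) - (k - i) mod int l')"
          using uv(2) by (simp add: a_def l'_def)
        then show "int l' dvd i + int a - k" by (simp only: dvd_minus_iff dvd_minus_mod)
      qed
      have "window x (i + int a) l' = window x (j + int a) l'"
        by (rule window_eq_sub[OF eq]) (use a in simp)
      then have "int l' dvd j + int a - k" using k[of "i + int a"] k[of "j + int a"] a(2) by simp
      then have "int l' dvd (i + int a - k) - (j + int a - k)" using a(2) dvd_diff by blast
      then show ?thesis by simp
    qed
    ultimately show ?thesis using uv(2) by (auto simp: tower_level_def l'_def)
  qed
  moreover have "tower_step x (l, q) (l', q')"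
  proof -
    have "l dvd l'" using uv(3) by (metis dvd_mult_right l'_def)
    moreover have "2 * l \<le> l'" using \<open>3 * l \<le> l'\<close> by simp
    moreover have "int l dvd q' - q"
    proof -
      have "q' - q = int l - ((q - k) - (q - k) mod int l)" using l by (simp add: q'_def c_def)
      then show ?thesis by (simp only: dvd_diff dvd_minus_mod dvd_refl)
    qed
    moreover have "window x (q' + i * int l') l = window x (q' + j * int l') l" for i j
    proof (rule window_eqI)
      fix t assume "t < l"
      then show "x (q' + i * int l' + int t) = x (q' + j * int l' + int t)"
        using prefix[of "c + t"] c by (simp add: q'_def algebra_simps)
    qed
    moreover have "window x (q' + i * int l' - int l) l = window x (q' + j * int l' - int l) l" for i j
    proof (rule window_eqI)
      fix t assume "t < l"
      then show "x (q' + i * int l' - int l + int t) = x (q' + j * int l' - int l + int t)"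
        using prefix[of "c - l + t"] c by (simp add: q'_def algebra_simps of_nat_diff)
    qed
    ultimately show ?thesis unfolding tower_step_def by blast
  qed
  ultimately show thesis using that by blast
qed

text \<open>Iterating \<open>tower_step_exists\<close> from the cutting into letters gives cuttings of one point of \<open>X\<close> at all
scales, each refining the next. Coding the blocks of each cutting by letters gives a
\<open>block_tower\<close>.\<close>

theorem tilable_imp_strong_Toeplitz:
  assumes X: "X \<in> infinite_minimal_subshifts" and tilable: "\<And>m. 0 < m \<Longrightarrow> two_block_tilable m X"
  shows "strong_Toeplitz_rank 2 X"
proof -
  have sub: "X \<in> subshifts" and "X \<noteq> {}"
    using X by (auto simp: infinite_minimal_subshifts_def)
  then obtain x where x: "x \<in> X" by blast
  have fin: "finite (range x)"
    using sub x by (auto simp: subshifts_def full_shift_def intro: finite_subset)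
  have "\<exists>p. \<forall>n. tower_level x n (p n) \<and> tower_step x (p n) (p (Suc n))"
  proof (rule dependent_nat_choice)
    show "\<exists>p. tower_level x 0 p"
      by (rule exI[of _ "(1, 0)"]) (simp add: tower_level_def)
    fix p n assume p: "tower_level x n p"
    obtain l q where lq: "p = (l, q)" by fastforce
    have l: "0 < l" using p lq by (auto simp: tower_level_def)
    show "\<exists>p'. tower_level x (Suc n) p' \<and> tower_step x p p'"
      using tower_step_exists[OF sub x tilable l, of n q] l lq by (metis mult_pos_pos zero_less_numeral)
  qed
  then obtain p where p: "\<And>n. tower_level x n (p n)" "\<And>n. tower_step x (p n) (p (Suc n))" by blast
  define l where "l n = fst (p n)" for n
  define q where "q n = snd (p n)" for n
  have level: "tower_level x n (l n, q n)" and step: "tower_step x (l n, q n) (l (Suc n), q (Suc n))" for n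
    using p by (simp_all add: l_def q_def)
  have lpos: "0 < l n" for n using level[of n] by (auto simp: tower_level_def)
  have lq0: "l 0 = 1" "q 0 = 0" using level[of 0] by (auto simp: tower_level_def)
  define r where "r n = l (Suc n) div l n" for n
  define s where "s n = (q (Suc n) - q n) div int (l n)" for n
  have r: "l (Suc n) = r n * l n" and s: "q (Suc n) = q n + s n * int (l n)" for n
    using step[of n] by (auto simp: tower_step_def r_def s_def)
  define B where "B n j = window x (q n + j * int (l n)) (l n)" for n j
  \<comment> \<open>Any injective coding of blocks would do; at level \<open>0\<close> the identity makes the generated
    subshift equal to \<open>X\<close> and not just conjugate to it.\<close>
  define y where "y n j = (if n = 0 then x j else int (to_nat (B n j)))" for n j
  have y_eq: "y n i = y n j \<longleftrightarrow> B n i = B n j" for n i j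
    by (auto simp: y_def B_def lq0)
  have y_window: "window (y n) i k = window (y n) j k \<longleftrightarrow>
      window x (q n + i * int (l n)) (k * l n) = window x (q n + j * int (l n)) (k * l n)" for n i j k
  proof
    assume w: "window (y n) i k = window (y n) j k"
    show "window x (q n + i * int (l n)) (k * l n) = window x (q n + j * int (l n)) (k * l n)"
    proof (rule window_eqI)
      fix t assume t: "t < k * l n"
      define d where "d = t div l n"
      define e where "e = t mod l n"
      have de: "t = d * l n + e" "e < l n" "d < k"
        using lpos[of n] t by (simp_all add: d_def e_def div_mult_mod_eq less_mult_imp_div_less)
      have "B n (i + int d) = B n (j + int d)"
        using window_eqD[OF w de(3)] y_eq by blast
      from window_eqD[OF this[unfolded B_def] de(2)]
      show "x (q n + i * int (l n) + int t) = x (q n + j * int (l n) + int t)"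
        by (simp add: de(1) algebra_simps)
    qed
  next
    assume w: "window x (q n + i * int (l n)) (k * l n) = window x (q n + j * int (l n)) (k * l n)"
    show "window (y n) i k = window (y n) j k"
    proof (rule window_eqI)
      fix t assume "t < k"
      then have "t * l n + l n \<le> k * l n"
        using mult_le_mono1[of "Suc t" k "l n"] by simp
      from window_eq_sub[OF w this] show "y n (i + int t) = y n (j + int t)"
        by (simp add: y_eq B_def algebra_simps)
    qed
  qed
  have card_y: "finite (range (y (Suc n)))" "card (range (y (Suc n))) \<le> 2" for n
  proof -
    have "range (y (Suc n)) = (\<lambda>w. int (to_nat w)) ` range (B (Suc n))"
      by (auto simp: y_def)
    moreover have "finite (range (B (Suc n)))" "card (range (B (Suc n))) \<le> 2"
      using level[of "Suc n"] by (auto simp: tower_level_def B_def)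
    ultimately show "finite (range (y (Suc n)))" "card (range (y (Suc n))) \<le> 2"
      using card_image_le[of "range (B (Suc n))" "\<lambda>w. int (to_nat w)"] by auto
  qed
  have y0: "y 0 = x" by (simp add: y_def fun_eq_iff)
  interpret block_tower y r s
  proof
    fix n i j
    show "finite (range (y n))" using card_y fin by (cases n) (simp_all add: y0)
    have "2 * l n \<le> r n * l n" using step[of n] r[of n] by (simp add: tower_step_def)
    then show "2 \<le> r n" using lpos[of n] by simp
    have aligned: "q n + (s n + i * int (r n)) * int (l n) = q (Suc n) + i * int (l (Suc n))" for i
      by (simp add: r s algebra_simps)
    show "y (Suc n) i = y (Suc n) j \<longleftrightarrow>
        window (y n) (s n + i * int (r n)) (r n) = window (y n) (s n + j * int (r n)) (r n)"
      unfolding y_window y_eq aligned by (simp add: B_def r)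
    show "\<exists>L. \<forall>i j. window (y n) i L = window (y n) j L \<longrightarrow> int (r n) dvd i - j"
    proof -
      obtain L where L: "\<And>i j. window x i L = window x j L \<Longrightarrow> int (l (Suc n)) dvd i - j"
        using level[of "Suc n"] by (auto simp: tower_level_def)
      show ?thesis
      proof (intro exI[of _ L] allI impI)
        fix i j assume "window (y n) i L = window (y n) j L"
        then have w: "window x (q n + i * int (l n)) (L * l n) = window x (q n + j * int (l n)) (L * l n)"
          by (simp add: y_window)
        have "L * 1 \<le> L * l n" using lpos[of n] by (intro mult_left_mono) auto
        then have "window x (q n + i * int (l n)) L = window x (q n + j * int (l n)) L"
          using window_eq_sub[OF w, of 0 L] by simp
        then have "int (l (Suc n)) dvd (i - j) * int (l n)"
          using L by (fastforce simp: algebra_simps)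
        then show "int (r n) dvd i - j"
          using lpos[of n] by (simp add: r)
      qed
    qed
    show "y n (s n + i * int (r n)) = y n (s n + j * int (r n))"
      using step[of n] unfolding y_eq B_def aligned by (auto simp: tower_step_def)
    have aligned': "q n + (s n + i * int (r n) - 1) * int (l n) = q (Suc n) + i * int (l (Suc n)) - int (l n)" for i
      using aligned[of i] by (simp add: algebra_simps)
    show "y n (s n + i * int (r n) - 1) = y n (s n + j * int (r n) - 1)"
      using step[of n] unfolding y_eq B_def aligned' by (auto simp: tower_step_def)
  next
    show "uniformly_recurrent (y 0)"
      unfolding y0 using minimal_uniformly_recurrent[OF X x] .
  qed
  have "strong_Toeplitz_rank 2 (orbit_hull (y 0))"
    by (rule strong_Toeplitz) (simp add: alphabet_def card_y)
  then show ?thesis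
    using minimal_subshift_orbit_hull[OF X x] by (simp add: y0)
qed

section \<open>Languages and the metric\<close>

lemma take_window: "l \<le> N \<Longrightarrow> take l (window x i N) = window x i l"
  by (rule nth_equalityI) auto

lemma language_shorter:
  assumes "language N X = language N Y" "l \<le> N"
  shows "language l X = language l Y"
proof -
  have "language l Z = take l ` language N Z" for Z :: "(int \<Rightarrow> 'a) set"
    using assms(2) by (force simp: language_def take_window image_iff)
  then show ?thesis using assms(1) by simp
qed

lemma language_eq_if_dist_less:
  assumes "subshift_dist X Y < (1/2) ^ N"
  shows "language N X = language N Y"
proof (rule ccontr)
  assume ne: "language N X \<noteq> language N Y"
  then have "Inf {n. language n X \<noteq> language n Y} \<le> N" by (intro cInf_lower) auto
  then have "(1/2::real) ^ N \<le> (1/2) ^ Inf {n. language n X \<noteq> language n Y}"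
    by (intro power_decreasing) auto
  moreover have "\<not> (\<forall>n. language n X = language n Y)" using ne by blast
  then have "subshift_dist X Y = (1/2) ^ Inf {n. language n X \<noteq> language n Y}"
    by (simp only: subshift_dist_def if_False)
  ultimately show False using assms by linarith
qed

lemma dist_less_if_language_eq:
  assumes "language N X = language N Y"
  shows "subshift_dist X Y < (1/2) ^ N"
proof (cases "\<forall>n. language n X = language n Y")
  case True
  then show ?thesis by (simp add: subshift_dist_def)
next
  case False
  define m where "m = Inf {n. language n X \<noteq> language n Y}"
  have "language m X \<noteq> language m Y"
    using Inf_nat_def1[of "{n. language n X \<noteq> language n Y}"] False by (auto simp: m_def)
  then have "N < m" using language_shorter[OF assms, of m] by (metis not_le)
  then have "(1/2::real) ^ m < (1/2) ^ N" by (intro power_strict_decreasing) auto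
  then show ?thesis using False by (simp add: subshift_dist_def m_def)
qed

lemma unique_tile_local:
  assumes eq: "window z 0 (2 * length u) = window x 0 (2 * length u)"
    and x: "\<exists>!i. 0 \<le> i \<and> i < int (length u) \<and> window x i (length u) \<in> W"
  shows "\<exists>!i. 0 \<le> i \<and> i < int (length u) \<and> window z i (length u) \<in> W"
proof -
  have "window z i (length u) = window x i (length u)" if "0 \<le> i" "i < int (length u)" for i
    using window_eq_sub[OF eq, of "nat i" "length u"] that by simp
  then have "(0 \<le> i \<and> i < int (length u) \<and> window z i (length u) \<in> W)
      = (0 \<le> i \<and> i < int (length u) \<and> window x i (length u) \<in> W)" for i by auto
  then show ?thesis using x by simp
qed

lemma tiled_by_local:
  assumes Y: "Y \<in> subshifts" and L: "language (2 * length u) X = language (2 * length u) Y"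
    and tiled: "tiled_by Y u v"
  shows "tiled_by X u v"
  unfolding tiled_by_def
proof
  fix x assume "x \<in> X"
  then have "window x 0 (2 * length u) \<in> language (2 * length u) Y"
    unfolding L[symmetric] by (auto simp: language_def)
  then obtain y k where y: "y \<in> Y" "window x 0 (2 * length u) = window y k (2 * length u)"
    by (auto simp: language_def)
  show "\<exists>!i. 0 \<le> i \<and> i < int (length u) \<and> window x i (length u) \<in> {u, v}"
  proof (rule unique_tile_local)
    show "window x 0 (2 * length u) = window (shift_by k y) 0 (2 * length u)" using y(2) by simp
    show "\<exists>!i. 0 \<le> i \<and> i < int (length u) \<and> window (shift_by k y) i (length u) \<in> {u, v}"
      using tiled shift_by_subshift[OF Y y(1), of k] unfolding tiled_by_def by blast
  qed
qed

lemma openin_two_block_tilable: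
  "openin subshift_space.mtopology {X \<in> subshifts. two_block_tilable m X}"
  unfolding subshift_space.openin_mtopology
proof (intro conjI allI impI)
  show "{X \<in> subshifts. two_block_tilable m X} \<subseteq> subshifts" by blast
  fix X assume X: "X \<in> {X \<in> subshifts. two_block_tilable m X}"
  then obtain u v where uv: "length v = length u" "0 < length u" "m dvd length u"
      "take m u = take m v" "tiled_by X u v"
    unfolding two_block_tilable_def by blast
  show "\<exists>e>0. subshift_space.mball X e \<subseteq> {X \<in> subshifts. two_block_tilable m X}"
  proof (intro exI[of _ "(1/2) ^ (2 * length u)"] conjI subsetI)
    fix Y assume Y: "Y \<in> subshift_space.mball X ((1/2) ^ (2 * length u))"
    then have "language (2 * length u) Y = language (2 * length u) X"
      using language_eq_if_dist_less[of X Y] by auto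
    then have "tiled_by Y u v" using tiled_by_local[of X] X uv(5) by blast
    then show "Y \<in> {X \<in> subshifts. two_block_tilable m X}"
      using Y uv unfolding two_block_tilable_def by auto
  qed simp
qed

section \<open>A hierarchy of two-word tilings\<close>

text \<open>With these numbers \<open>ratio j = 6 * (j + 1)\<close>, so the tile length of level \<open>Suc j\<close> is a multiple of
\<open>Suc j\<close>, the run is at least \<open>Suc j\<close> long, and \<open>run j \<ge> 4\<close> as needed in \<open>tile_positions\<close>.\<close>

definition run :: "nat \<Rightarrow> nat" where
  "run j = 6 * j + 4"

definition ratio :: "nat \<Rightarrow> nat" where
  "ratio j = run j + 2"

text \<open>The pattern \<open>a\<^sup>K b b\<close> for \<open>c = True\<close> and \<open>a\<^sup>K b a\<close> for \<open>c = False\<close>, where \<open>K = run j\<close> and where \<open>True\<close>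
stands for \<open>a\<close> and \<open>False\<close> for \<open>b\<close>.\<close>

definition pattern :: "nat \<Rightarrow> bool \<Rightarrow> nat \<Rightarrow> bool" where
  "pattern j c k = (if k < run j then True else if k = run j then False else \<not> c)"

text \<open>A coloured hierarchy on the integers: the cells of level \<open>Suc j\<close> consist of \<open>ratio j\<close> cells of level \<open>j\<close>,
coloured by \<open>pattern j c\<close> if the large cell has colour \<open>c\<close>. The cell \<open>0\<close> of level \<open>j\<close> is the second one in
the cell \<open>0\<close> of level \<open>Suc j\<close>, whence the shift \<open>t + 1\<close>: in this way the cells \<open>0\<close> grow in both
directions and exhaust the integers. The cell indices shrink towards \<open>0\<close>, where all colours are
\<open>True\<close>.\<close>

function colour :: "nat \<Rightarrow> int \<Rightarrow> bool" where
  "colour j t = (if t = 0 then True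
     else pattern j (colour (Suc j) ((t + 1) div int (ratio j))) (nat ((t + 1) mod int (ratio j))))"
  by pat_completeness auto
termination
proof (relation "Wellfounded.measure (\<lambda>(j, t). nat \<bar>t\<bar>)")
  fix j and t :: int
  assume t: "t \<noteq> 0"
  define R where "R = int (ratio j)"
  have R: "6 \<le> R" by (simp add: R_def ratio_def run_def)
  have "\<bar>(t + 1) div R\<bar> < \<bar>t\<bar>"
  proof (cases "0 < t")
    case True
    have "0 \<le> (t + 1) div R" using True R by (simp add: pos_imp_zdiv_nonneg_iff)
    moreover have "t * 6 \<le> t * R" using R True by (intro mult_left_mono) auto
    then have "t + 1 < t * R" using True by linarith
    have "(t + 1) div R * R \<le> t + 1"
      using R div_mult_mod_eq[of "t + 1" R] pos_mod_sign[of R "t + 1"] by linarith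
    then have "(t + 1) div R * R < t * R" using \<open>t + 1 < t * R\<close> by linarith
    then have "(t + 1) div R < t" using R by (simp add: mult_less_cancel_right)
    ultimately show ?thesis by simp
  next
    case False
    then have "t < 0" using t by simp
    then have "(t + 1) * R \<le> (t + 1) * 1" using R by (intro mult_left_mono_neg) auto
    then have "(t + 1) * R div R \<le> (t + 1) div R" using R by (intro zdiv_mono1) auto
    then have "t + 1 \<le> (t + 1) div R" using R by simp
    moreover have "(t + 1) div R \<le> 0 div R" using \<open>t < 0\<close> R by (intro zdiv_mono1) auto
    ultimately show ?thesis using \<open>t < 0\<close> by simp
  qed
  then show "((Suc j, (t + 1) div int (ratio j)), (j, t)) \<in> Wellfounded.measure (\<lambda>(j, t). nat \<bar>t\<bar>)"
    by (simp add: R_def)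
qed simp

declare colour.simps [simp del]

lemma colour_0: "colour j 0 = True"
  by (simp add: colour.simps)

text \<open>The defining equation of \<open>colour\<close> without its exception for \<open>t = 0\<close>, which agrees with the general rule.\<close>

lemma colour_refine:
  assumes "k < ratio j"
  shows "colour j (t * int (ratio j) + int k - 1) = pattern j (colour (Suc j) t) k"
proof -
  have "int k < int (ratio j)" using assms by simp
  then have "(t * int (ratio j) + int k) div int (ratio j) = t"
    "(t * int (ratio j) + int k) mod int (ratio j) = int k" by simp_all
  moreover have "pattern j (colour (Suc j) t) k" if "t * int (ratio j) + int k - 1 = 0"
  proof -
    have "(t * int (ratio j) + int k) mod int (ratio j) = 1"
      using that by (simp add: ratio_def run_def)
    then have "k = 1" using \<open>_ mod _ = int k\<close> by simp
    then show ?thesis by (simp add: pattern_def run_def)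
  qed
  ultimately show ?thesis by (subst colour.simps) auto
qed

text \<open>Two different words \<open>w True\<close> and \<open>w False\<close> of the same length \<open>p\<close>. Substituting them for the two colours of level \<open>0\<close> gives
a point that is tiled at each level \<open>j\<close> by the two words \<open>tile j True\<close> and \<open>tile j False\<close>.\<close>

locale word_pair =
  fixes w :: "bool \<Rightarrow> nat \<Rightarrow> int" and p :: nat
  assumes p: "0 < p" and differ: "\<exists>i<p. w True i \<noteq> w False i"
begin

fun len :: "nat \<Rightarrow> nat" where
  "len 0 = p"
| "len (Suc j) = ratio j * len j"

fun word :: "nat \<Rightarrow> bool \<Rightarrow> nat \<Rightarrow> int" where
  "word 0 c i = w c i"
| "word (Suc j) c i = word j (pattern j c (i div len j)) (i mod len j)"

fun offset :: "nat \<Rightarrow> nat" where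
  "offset 0 = 0"
| "offset (Suc j) = offset j + len j"

definition point :: "int \<Rightarrow> int" where
  "point i = w (colour 0 (i div int p)) (nat (i mod int p))"

lemma len_pos: "0 < len j"
  by (induction j) (simp_all add: p ratio_def)

lemma point_tile:
  "i < len j \<Longrightarrow> point (t * int (len j) - int (offset j) + int i) = word j (colour j t) i"
proof (induction j arbitrary: t i)
  case 0
  then show ?case by (simp add: point_def)
next
  case (Suc j)
  define k where "k = i div len j"
  define i' where "i' = i mod len j"
  have i: "i = k * len j + i'" "i' < len j" "k < ratio j"
    using Suc.prems len_pos[of j]
    by (simp_all only: k_def i'_def div_mult_mod_eq less_mult_imp_div_less mod_less_divisor len.simps)
  have "t * int (len (Suc j)) - int (offset (Suc j)) + int i
      = (t * int (ratio j) + int k - 1) * int (len j) - int (offset j) + int i'"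
    by (simp add: i(1) algebra_simps)
  then have "point (t * int (len (Suc j)) - int (offset (Suc j)) + int i)
      = word j (colour j (t * int (ratio j) + int k - 1)) i'"
    using Suc.IH[OF i(2)] by (simp only:)
  then show ?case using i(3) by (simp add: colour_refine k_def i'_def)
qed

lemma word_prefix: "i < run j * len j \<Longrightarrow> word (Suc j) c i = word j True (i mod len j)"
  by (simp add: pattern_def less_mult_imp_div_less)

lemma word_marker: "i < len j \<Longrightarrow> word (Suc j) c (run j * len j + i) = word j False i"
  using len_pos[of j] by (simp add: pattern_def)

lemma word_differ: "\<exists>i<len j. word j True i \<noteq> word j False i"
proof (induction j)
  case 0
  then show ?case using differ by simp
next
  case (Suc j)
  then obtain i where i: "i < len j" "word j True i \<noteq> word j False i" by blast
  define i' where "i' = (run j + 1) * len j + i"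
  have "i' < ratio j * len j" using i(1) by (simp add: i'_def ratio_def)
  moreover have "i' div len j = run j + 1" "i' mod len j = i"
    unfolding i'_def using i(1) len_pos[of j] by (simp_all del: mult_Suc add_mult_distrib)
  ultimately show ?case using i(2) by (intro exI[of _ i']) (simp add: pattern_def)
qed

definition tile :: "nat \<Rightarrow> bool \<Rightarrow> int list" where
  "tile j c = map (word j c) [0..<len j]"

lemma length_tile [simp]: "length (tile j c) = len j"
  by (simp add: tile_def)

lemma window_point: "window point (t * int (len j) - int (offset j)) (len j) = tile j (colour j t)"
  by (rule window_eq_nthI) (simp_all add: tile_def point_tile)

end

text \<open>Two occurrences of the word \<open>a\<^sup>K b\<close> with \<open>a \<noteq> b\<close>, where \<open>a\<close> and \<open>b\<close> have length \<open>l\<close>, are more than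
\<open>(K - 1) * l\<close> apart. In such an occurrence the period \<open>l\<close> breaks for the first time where \<open>b\<close> first differs
from \<open>a\<close>. If a second occurrence started only slightly later, this place would lie in its periodic
part.\<close>

lemma marked_run_separation:
  fixes a b :: "nat \<Rightarrow> 'a" and l K :: nat
  assumes ab: "\<exists>t<l. a t \<noteq> b t" and K: "0 < K"
    and i: "\<And>t. t < K * l \<Longrightarrow> x (i + int t) = a (t mod l)" "\<And>t. t < l \<Longrightarrow> x (i + int (K * l + t)) = b t"
    and i': "\<And>t. t < K * l \<Longrightarrow> x (i' + int t) = a (t mod l)" "\<And>t. t < l \<Longrightarrow> x (i' + int (K * l + t)) = b t"
    and less: "i < i'"
  shows "int ((K - 1) * l) < i' - i"
proof (rule ccontr)
  assume near: "\<not> int ((K - 1) * l) < i' - i"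
  define m where "m = (LEAST t. t < l \<and> a t \<noteq> b t)"
  have "m < l \<and> a m \<noteq> b m" unfolding m_def using ab by (rule LeastI_ex)
  then have m: "m < l" "a m \<noteq> b m" by auto
  have agree: "a t = b t" if "t < m" for t
    using not_less_Least[of t "\<lambda>t. t < l \<and> a t \<noteq> b t"] that m(1) by (auto simp: m_def)
  define d where "d = nat (i' - i)"
  have d: "i' = i + int d" "0 < d" "d \<le> (K - 1) * l"
    using less near by (simp_all del: of_nat_mult add: d_def nat_le_iff)
  have Kl: "K * l = (K - 1) * l + l" using K by (cases K) auto
  define e where "e = K * l + m - d"
  have e: "e + d = K * l + m" "l \<le> e" "e < K * l + m" using d Kl by (simp_all add: e_def)
  have "x (i' + int e) = a ((e - l) mod l)"
  proof (cases "e < K * l")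
    case True
    then show ?thesis using i'(1)[OF True] e(2) by (simp add: le_mod_geq)
  next
    case False
    define t where "t = e - K * l"
    have t: "e = K * l + t" "t < m" using False e by (simp_all add: t_def)
    then have "x (i' + int e) = a t" using i'(2)[of t] agree m by simp
    moreover have "e - l = (K - 1) * l + t" using t Kl by simp
    ultimately show ?thesis using t m by simp
  qed
  moreover have "x (i' + int (e - l)) = a ((e - l) mod l)"
    using e m Kl by (intro i'(1)) simp
  ultimately have "x (i' + int e) = x (i' + int (e - l))" by simp
  moreover have "i' + int e = i + int (K * l + m)" using d(1) e(1) by linarith
  moreover have "i' + int (e - l) = i + int ((K - 1) * l + m)"
    using d(1) e(1,2) Kl by linarith
  moreover have "x (i + int (K * l + m)) = b m" by (rule i(2)) (rule m)
  moreover have "x (i + int ((K - 1) * l + m)) = a m"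
    using i(1)[of "(K - 1) * l + m"] m Kl by simp
  ultimately show False using m by simp
qed

context word_pair
begin

text \<open>The tiles of level \<open>Suc j\<close> occur only where the hierarchy puts them. They both start with \<open>a\<^sup>K b\<close> and have
length \<open>(K + 2) * len j\<close>. An occurrence at a wrong place would have distance more than
\<open>(K - 1) * len j\<close> from the right places on both sides of it, which is too much as \<open>K \<ge> 4\<close>.\<close>

lemma tile_positions:
  "window point i (len (Suc j)) \<in> {tile (Suc j) True, tile (Suc j) False} \<longleftrightarrow>
     int (len (Suc j)) dvd i + int (offset (Suc j))" (is "?P i \<longleftrightarrow> _")
proof
  define l where "l = len (Suc j)"
  define q where "q = int (offset (Suc j))"
  have l: "0 < l" unfolding l_def by (rule len_pos)
  have l_eq: "l = run j * len j + len j + len j" by (simp add: l_def ratio_def)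
  have at: "?P (t * int l - q)" for t
    unfolding l_def q_def window_point by (cases "colour (Suc j) t") simp_all
  {
    assume "int l dvd i + q"
    then obtain d where "i + q = int l * d" by (rule dvdE)
    then have "i = d * int l - q" by (simp add: algebra_simps)
    then show "?P i" using at[of d] by simp
  }
  have nth: "x (i + int t) = word (Suc j) c t"
    if "window x i l = tile (Suc j) c" "t < l" for x i c t
    using nth_window[OF that(2), of x i] that by (simp add: tile_def l_def)
  have mark: "point (i + int t) = word j True (t mod len j)" if P: "?P i" and t: "t < run j * len j" for i t
  proof -
    obtain c where "window point i l = tile (Suc j) c" using P unfolding l_def by blast
    then show ?thesis using nth[of point i c t] word_prefix[OF t] t l_eq by simp
  qed
  have mark': "point (i + int (run j * len j + t)) = word j False t" if P: "?P i" and t: "t < len j" for i t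
  proof -
    obtain c where "window point i l = tile (Suc j) c" using P unfolding l_def by blast
    then show ?thesis
      using nth[of point i c "run j * len j + t"] word_marker[OF t] t l_eq by simp
  qed
  have sep: "int ((run j - 1) * len j) < i' - i" if "?P i" "?P i'" "i < i'" for i i'
    by (rule marked_run_separation[where a = "word j True" and b = "word j False" and x = point])
      (use that mark mark' word_differ in \<open>auto simp: run_def\<close>)
  assume P: "?P i"
  define t where "t = (i + q) div int l"
  define d where "d = (i + q) mod int l"
  have i: "i = t * int l - q + d" "0 \<le> d" "d < int l"
    using l div_mult_mod_eq[of "i + q" "int l"] unfolding t_def d_def by (linarith, simp_all)
  have "d = 0"
  proof (rule ccontr)
    assume "d \<noteq> 0"
    then have "t * int l - q < i" "i < (t + 1) * int l - q"
      using i by (simp_all add: algebra_simps)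
    then have "int ((run j - 1) * len j) < i - (t * int l - q)"
      "int ((run j - 1) * len j) < ((t + 1) * int l - q) - i"
      using sep at P by blast+
    then have "2 * int ((run j - 1) * len j) < int l" by (simp add: algebra_simps)
    then have "int (2 * ((run j - 1) * len j)) < int (ratio j * len j)" by (simp add: l_def)
    then have "2 * ((run j - 1) * len j) < ratio j * len j" by (simp only: of_nat_less_iff)
    then have "2 * (run j - 1) * len j < ratio j * len j" by (simp only: mult.assoc)
    then have "2 * (run j - 1) < ratio j" by (simp only: mult_less_cancel2)
    then show False by (simp add: run_def ratio_def)
  qed
  then have "i + q = int l * t" using i by (simp add: algebra_simps)
  then show "int l dvd i + q" by simp
qed

lemma tiled_orbit_hull: "tiled_by (orbit_hull point) (tile (Suc j) True) (tile (Suc j) False)"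
  unfolding tiled_by_def length_tile
proof
  fix z assume z: "z \<in> orbit_hull point"
  let ?l = "len (Suc j)" and ?q = "int (offset (Suc j))"
  obtain k where k: "window z 0 (2 * ?l) = window point k (2 * ?l)"
    using z by (rule orbit_hullD)
  have l: "0 < ?l" by (rule len_pos)
  have "\<exists>!i. 0 \<le> i \<and> i < int ?l \<and> int ?l dvd i + k + ?q"
  proof (rule ex1I[of _ "(- (k + ?q)) mod int ?l"])
    have "int ?l dvd (- (k + ?q)) mod int ?l - (- (k + ?q))"
      by (rule mod_eq_dvd_iff[THEN iffD1]) (rule mod_mod_trivial)
    then show "0 \<le> (- (k + ?q)) mod int ?l \<and> (- (k + ?q)) mod int ?l < int ?l \<and>
        int ?l dvd (- (k + ?q)) mod int ?l + k + ?q"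
      using l by (simp add: algebra_simps del: len.simps)
  next
    fix i assume i: "0 \<le> i \<and> i < int ?l \<and> int ?l dvd i + k + ?q"
    then have "int ?l dvd i - (- (k + ?q))" by (simp add: algebra_simps del: len.simps)
    then have "i mod int ?l = (- (k + ?q)) mod int ?l" by (simp only: mod_eq_dvd_iff)
    then show "i = (- (k + ?q)) mod int ?l" using i by simp
  qed
  then have uniq: "\<exists>!i. 0 \<le> i \<and> i < int ?l \<and>
      window (shift_by k point) i ?l \<in> {tile (Suc j) True, tile (Suc j) False}"
    by (simp only: window_shift_by tile_positions)
  have "window z 0 (2 * ?l) = window (shift_by k point) 0 (2 * ?l)"
    using k by (simp only: window_shift_by add_0)
  from unique_tile_local[of z "tile (Suc j) True", unfolded length_tile, OF this uniq]
  show "\<exists>!i. 0 \<le> i \<and> i < int ?l \<and> window z i ?l \<in> {tile (Suc j) True, tile (Suc j) False}" .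
qed

lemma two_block_tilable_orbit_hull:
  assumes "0 < m"
  shows "two_block_tilable m (orbit_hull point)"
proof -
  define j where "j = m - 1"
  have m: "m = Suc j" using assms by (simp add: j_def)
  have "ratio j = 6 * m" by (simp add: ratio_def run_def m)
  then have "m dvd len (Suc j)" by simp
  moreover have "take m (tile (Suc j) True) = take m (tile (Suc j) False)"
  proof -
    have "m * 1 \<le> run j * len j"
      using len_pos[of j] by (intro mult_le_mono) (simp_all add: m run_def)
    then have "word (Suc j) True i = word (Suc j) False i" if "i < m" for i
      using that word_prefix[of i j] by simp
    then show ?thesis
      by (intro nth_equalityI) (simp_all add: tile_def del: word.simps len.simps)
  qed
  ultimately show ?thesis
    unfolding two_block_tilable_def
    using tiled_orbit_hull[of j] len_pos[of "Suc j"] by (metis length_tile)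
qed

lemma len_large: "j + offset j \<le> len j" "j \<le> offset j"
proof -
  show "j \<le> offset j"
  proof (induction j)
    case (Suc j)
    then show ?case using len_pos[of j] by simp
  qed simp
  show "j + offset j \<le> len j"
  proof (induction j)
    case (Suc j)
    have "6 * len j \<le> len (Suc j)"
      unfolding len.simps by (intro mult_le_mono1) (simp add: ratio_def run_def)
    then show ?case using Suc len_pos[of j] unfolding offset.simps by linarith
  qed simp
qed

lemma finite_range_point: "finite (range point)"
proof (rule finite_subset)
  show "range point \<subseteq> (\<lambda>(c, i). w c i) ` (UNIV \<times> {..<p})"
  proof
    fix a assume "a \<in> range point"
    then obtain i where "a = point i" by blast
    moreover have "nat (i mod int p) < p" using p by (simp add: nat_less_iff)
    ultimately show "a \<in> (\<lambda>(c, i). w c i) ` (UNIV \<times> {..<p})"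
      unfolding point_def by blast
  qed
qed simp

text \<open>Every window lies in a cell \<open>0\<close> of some level \<open>N\<close>, which has colour \<open>True\<close>. Each tile of level \<open>Suc N\<close>
starts with a tile \<open>True\<close> of level \<open>N\<close>, so these recur with bounded gaps.\<close>

lemma uniformly_recurrent_point: "uniformly_recurrent point"
  unfolding uniformly_recurrent_def
proof (intro allI)
  fix i l
  define N where "N = nat \<bar>i\<bar> + l"
  define a where "a = nat (i + int (offset N))"
  have N: "int N = \<bar>i\<bar> + int l" by (simp add: N_def)
  have "0 \<le> i + int (offset N)" using N len_large(2)[of N] by linarith
  then have a: "int a = i + int (offset N)" "a + l \<le> len N"
    using N len_large(1)[of N] by (simp_all add: a_def)
  define M where "M = len (Suc N)"
  define c where "c = int a - int (offset (Suc N))"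
  have M: "0 < M" unfolding M_def by (rule len_pos)
  have rep: "window point (t * int M + c) l = window point i l" for t
  proof (rule window_eqI)
    fix s assume s: "s < l"
    have less: "a + s < len N" using a s by simp
    have "1 * len N \<le> run N * len N" by (intro mult_le_mono1) (simp add: run_def)
    then have less': "a + s < run N * len N" using less by linarith
    then have less'': "a + s < len (Suc N)" by (simp add: ratio_def)
    have "point (t * int M + c + int s) = word (Suc N) (colour (Suc N) t) (a + s)"
      using point_tile[OF less'', of t] by (simp add: c_def M_def algebra_simps del: len.simps offset.simps word.simps)
    also have "\<dots> = word N True (a + s)" using word_prefix[OF less'] less by simp
    also have "\<dots> = point (i + int s)"
      using point_tile[OF less, of 0] a(1) by (simp add: colour_0)
    finally show "point (t * int M + c + int s) = point (i + int s)" .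
  qed
  show "\<exists>R. \<forall>k. \<exists>j. k \<le> j \<and> j \<le> k + int R \<and> window point j l = window point i l"
  proof (intro exI[of _ M] allI)
    fix k
    define j where "j = k + (c - k) mod int M"
    have "j = (- ((c - k) div int M)) * int M + c"
      using div_mult_mod_eq[of "c - k" "int M"] by (simp add: j_def algebra_simps)
    then have "window point j l = window point i l" using rep by metis
    moreover have "k \<le> j" "j \<le> k + int M"
      using M by (simp_all add: j_def order_less_imp_le)
    ultimately show "\<exists>j. k \<le> j \<and> j \<le> k + int M \<and> window point j l = window point i l" by blast
  qed
qed

text \<open>A finite orbit closure would make the point periodic with some period \<open>d > 0\<close>. But occurrences of tiles
longer than \<open>d\<close> cannot be \<open>d\<close> apart.\<close>

lemma infinite_orbit_hull: "infinite (orbit_hull point)"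
proof
  assume "finite (orbit_hull point)"
  moreover have "range (\<lambda>k. shift_by k point) \<subseteq> orbit_hull point"
    using self_in_orbit_hull shift_by_orbit_hull by blast
  ultimately have "\<not> inj (\<lambda>k. shift_by k point)"
    using finite_subset range_inj_infinite infinite_UNIV_int finite_imageD by blast
  then obtain k k' where k: "k < k'" "shift_by k point = shift_by k' point"
    unfolding inj_def by (metis linorder_neqE)
  define d where "d = nat (k' - k)"
  define q where "q = int (offset (Suc d))"
  have "window point (0 - q + int d) (len (Suc d)) = window point (0 - q) (len (Suc d))"
    using arg_cong[OF k(2), of "\<lambda>x. window x (- q - k) (len (Suc d))"] k(1)
    by (simp add: d_def algebra_simps del: len.simps)
  then have "int (len (Suc d)) dvd 0 - q + int d + q \<longleftrightarrow> int (len (Suc d)) dvd 0 - q + q"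
    unfolding q_def tile_positions[symmetric] by simp
  then have "len (Suc d) dvd d" by (simp del: len.simps)
  then have "len (Suc d) \<le> d" using k(1) by (intro dvd_imp_le) (simp_all add: d_def)
  then show False using len_large(1)[of "Suc d"] by simp
qed

lemma orbit_hull_point_minimal: "orbit_hull point \<in> infinite_minimal_subshifts"
  using uniformly_recurrent_point finite_range_point infinite_orbit_hull
  by (rule uniformly_recurrent_minimal)

end

section \<open>Density\<close>

lemma finite_language:
  assumes "X \<in> subshifts" shows "finite (language n X)"
proof -
  obtain A where A: "finite A" "X \<subseteq> full_shift A" using assms unfolding subshifts_def by blast
  have "x i \<in> A" if "x \<in> X" for x i
    using A(2) that by (auto simp: full_shift_def)
  then have "language n X \<subseteq> {w. set w \<subseteq> A \<and> length w = n}"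
    by (auto simp: language_def window_def)
  then show ?thesis using finite_lists_length_eq[OF A(1)] finite_subset by blast
qed

lemma return_time:
  assumes "uniformly_recurrent x"
  obtains j :: nat where "m \<le> j" "window x (int j) l = window x i l"
proof -
  obtain R where "\<And>k. \<exists>j. k \<le> j \<and> j \<le> k + int R \<and> window x j l = window x i l"
    using uniformly_recurrentD[OF assms, of l i] by blast
  then obtain j where "int m \<le> j" "window x j l = window x i l" by blast
  then show thesis using that[of "nat j"] by (simp add: le_nat_iff)
qed

text \<open>If the window of length \<open>n\<close> at \<open>0\<close> returns at \<open>I\<close>, then repeating the first \<open>I\<close> letters of \<open>x\<close> creates no
new windows of length \<open>n\<close>. The function \<open>f\<close> describes a window that starts at position \<open>k\<close> in a repetition
of total length \<open>p\<close> and may run over its end, where it meets the first letters of \<open>x\<close> again.\<close>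

lemma periodic_window:
  assumes n: "n \<le> I" and ret: "window x (int I) n = window x 0 n" and dvd: "I dvd p"
    and k: "k < p" and f: "\<And>s. s < n \<Longrightarrow> f s = (if k + s < p then x (int ((k + s) mod I)) else x (int (k + s - p)))"
    and s: "s < n"
  shows "f s = x (int (k mod I) + int s)"
proof -
  define b where "b = k mod I"
  have "0 < I" using n s by simp
  then have b: "b < I" by (simp add: b_def)
  obtain c where c: "p = I * c" using dvd by (rule dvdE)
  define e where "e = k div I"
  have k_eq: "k = I * e + b" by (simp add: b_def e_def)
  have "e < c" using k c unfolding e_def by (simp add: less_mult_imp_div_less mult.commute)
  then have "I * (e + 1) \<le> I * c" by (intro mult_le_mono2) simp
  then have ec: "I * e + I \<le> p" by (simp add: c)
  have wrap: "x (int (b + s - I)) = x (int b + int s)" if "I \<le> b + s"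
  proof -
    have "b + s - I < n" using b s by simp
    from window_eqD[OF ret this] show ?thesis using that by (simp add: of_nat_diff)
  qed
  have "f s = x (int b + int s)"
  proof (cases "b + s < I")
    case True
    then have "k + s < p" using k_eq ec by simp
    moreover have "(k + s) mod I = b + s" using True by (simp add: k_eq add.assoc)
    ultimately show ?thesis using f[OF s] by simp
  next
    case False
    show ?thesis
    proof (cases "k + s < p")
      case True
      have "k + s = (b + s - I) + I * (e + 1)" using False k_eq by simp
      moreover have "b + s - I < I" using b s n by simp
      ultimately have "(k + s) mod I = b + s - I" by (simp only: mod_mult_self2 mod_less)
      then show ?thesis using f[OF s] True wrap False by simp
    next
      case no: False
      have "e + 1 = c"
      proof (rule ccontr)
        assume "e + 1 \<noteq> c"
        then have "e + 2 \<le> c" using \<open>e < c\<close> by simp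
        then have "I * (e + 2) \<le> I * c" by (intro mult_le_mono2)
        then show False using no k_eq b s n by (simp add: c)
      qed
      then have "I * e + I = p" by (auto simp: c)
      then have "k + s - p = b + s - I" using k_eq by simp
      then show ?thesis using f[OF s] no wrap False by simp
    qed
  qed
  then show ?thesis by (simp add: b_def)
qed

text \<open>For two return times \<open>I < J\<close> of the first \<open>n\<close> letters \<open>u\<close> of \<open>x\<close>, the words \<open>x(0) \<dots> x(I - 1)\<close>
and \<open>x(0) \<dots> x(J - 1)\<close>, repeated \<open>J\<close> and \<open>I\<close> times, have the same length. Both start with \<open>u\<close>,
so by \<open>periodic_window\<close> their concatenations contain only those words of length \<open>n\<close> that occur in \<open>X\<close>.
As \<open>x\<close> does not have period \<open>I\<close> on its right half, the two words differ once \<open>J\<close> is large. If \<open>J\<close> is so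
large that all words of length \<open>n\<close> occur in \<open>x(0) \<dots> x(J - 1)\<close>, the concatenations contain all of them. Hence the point constructed from
this pair of words generates a subshift close to \<open>X\<close>.\<close>

theorem tilable_dense:
  assumes X: "X \<in> infinite_minimal_subshifts"
  obtains Y where "Y \<in> infinite_minimal_subshifts" "language n Y = language n X"
    "\<And>m. 0 < m \<Longrightarrow> two_block_tilable m Y"
proof -
  have sub: "X \<in> subshifts" and "X \<noteq> {}"
    using X by (auto simp: infinite_minimal_subshifts_def)
  then obtain x where x: "x \<in> X" by blast
  have rec: "uniformly_recurrent x" using minimal_uniformly_recurrent[OF X x] .
  have lang: "language n X = range (\<lambda>j. window x j n)"
    using language_orbit_hull[of n x] minimal_subshift_orbit_hull[OF X x] by simp
  obtain I where I: "n + 1 \<le> I" "window x (int I) n = window x 0 n"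
    using rec by (rule return_time)
  obtain t0 where t0: "x (int t0) \<noteq> x (int (t0 mod I))"
    using minimal_not_eventually_periodic[OF X x, of I] I(1) by auto
  have "\<exists>j::nat. window x (int j) n = u" if "u \<in> language n X" for u
    using that return_time[OF rec] unfolding lang by (metis rangeE)
  then obtain g :: "int list \<Rightarrow> nat" where g: "\<And>u. u \<in> language n X \<Longrightarrow> window x (int (g u)) n = u"
    by metis
  define B where "B = Max (g ` language n X)"
  have B: "g u \<le> B" if "u \<in> language n X" for u
    using that finite_language[OF sub] by (simp add: B_def)
  obtain J where J: "n + B + t0 + 1 \<le> J" "window x (int J) n = window x 0 n"
    using rec by (rule return_time)
  define per where "per c = (if c then I else J)" for c
  define p where "p = I * J"
  have per: "n \<le> per c" "window x (int (per c)) n = window x 0 n" "per c dvd p" for c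
    using I J by (auto simp: per_def p_def)
  define w where "w c t = x (int (t mod per c))" for c t
  have "J \<le> p" "0 < p" using I(1) J(1) by (simp_all add: p_def)
  interpret word_pair w p
  proof
    have "w True t0 \<noteq> w False t0" "t0 < p" using t0 J(1) \<open>J \<le> p\<close> by (simp_all add: w_def per_def)
    then show "\<exists>i<p. w True i \<noteq> w False i" by blast
  qed (rule \<open>0 < p\<close>)
  have point: "window point (t * int p + int k) n = window x (int (k mod per (colour 0 t))) n"
    if k: "k < p" for t k
  proof (rule window_eqI)
    fix s assume s: "s < n"
    show "point (t * int p + int k + int s) = x (int (k mod per (colour 0 t)) + int s)"
    proof (rule periodic_window[OF per k, where f = "\<lambda>s. point (t * int p + int k + int s)", OF _ s])
      fix s assume s: "s < n"
      have n_less: "n < per c" "per c \<le> p" for c using I J by (simp_all add: per_def p_def)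
      show "point (t * int p + int k + int s) =
          (if k + s < p then x (int ((k + s) mod per (colour 0 t))) else x (int (k + s - p)))"
      proof (cases "k + s < p")
        case True
        then show ?thesis using point_tile[of "k + s" 0 t] by (simp add: w_def add.assoc)
      next
        case False
        have less: "k + s - p < n" using k s by simp
        then have "k + s - p < p" "k + s - p < per (colour 0 (t + 1))"
          using n_less[of "colour 0 (t + 1)"] by simp_all
        then have "point ((t + 1) * int p + int (k + s - p)) = x (int (k + s - p))"
          using point_tile[of "k + s - p" 0 "t + 1"] by (simp add: w_def)
        moreover have "(t + 1) * int p + int (k + s - p) = t * int p + int k + int s"
          using False by (simp add: of_nat_diff algebra_simps)
        ultimately show ?thesis by (simp only: False if_False)
      qed
    qed
  qed
  have "language n (orbit_hull point) = language n X"
    unfolding language_orbit_hull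
  proof
    show "range (\<lambda>j. window point j n) \<subseteq> language n X"
    proof
      fix u assume "u \<in> range (\<lambda>j. window point j n)"
      then obtain j where u: "u = window point j n" by blast
      have "j = (j div int p) * int p + int (nat (j mod int p))" "nat (j mod int p) < p"
        using \<open>0 < p\<close> by (simp_all add: nat_less_iff)
      then show "u \<in> language n X" unfolding u lang using point by (metis rangeI)
    qed
    show "language n X \<subseteq> range (\<lambda>j. window point j n)"
    proof
      fix u assume u: "u \<in> language n X"
      \<comment> \<open>The second of the two words really occurs: the cell \<open>0\<close> of level \<open>1\<close> contains the cells
        \<open>- 1, \<dots>, 4\<close> of level \<open>0\<close>, and \<open>3\<close> is the first one after the run of four.\<close>
      have "colour 0 3 = False"
        using colour_refine[of 4 0 0] by (simp add: ratio_def run_def pattern_def)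
      moreover have "g u < J" "g u < p" using B[OF u] J(1) \<open>J \<le> p\<close> by simp_all
      ultimately have "window point (3 * int p + int (g u)) n = u"
        using point[of "g u" 3] g[OF u] by (simp add: per_def)
      then show "u \<in> range (\<lambda>j. window point j n)" by (metis rangeI)
    qed
  qed
  then show thesis
    using that orbit_hull_point_minimal two_block_tilable_orbit_hull by blast
qed

theorem corollary4p10:
  shows "generic_in minimal_topology
           {X \<in> infinite_minimal_subshifts. strong_Toeplitz_finite_rank X}"
proof -
  define G where "G = {X \<in> infinite_minimal_subshifts. \<forall>m>0. two_block_tilable m X}"
  have M: "infinite_minimal_subshifts \<subseteq> subshifts" by (auto simp: infinite_minimal_subshifts_def)
  have top: "topspace minimal_topology = infinite_minimal_subshifts"
    using M by (simp add: minimal_topology_def Int_absorb1)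
  have "G \<subseteq> {X \<in> infinite_minimal_subshifts. strong_Toeplitz_finite_rank X}"
    using tilable_imp_strong_Toeplitz
    by (auto simp: G_def strong_Toeplitz_finite_rank_def intro!: exI[of _ 2])
  moreover have "gdelta_in minimal_topology G"
  proof -
    define U where "U m = {X \<in> infinite_minimal_subshifts. two_block_tilable m X}" for m
    have "openin minimal_topology (U m)" for m
    proof -
      have "U m = {X \<in> subshifts. two_block_tilable m X} \<inter> infinite_minimal_subshifts"
        using M by (auto simp: U_def)
      then show ?thesis
        unfolding minimal_topology_def openin_subtopology using openin_two_block_tilable by blast
    qed
    then have "gdelta_in minimal_topology (\<Inter>m\<in>{0<..}. U m)"
      by (intro gdelta_in_Inter) (auto intro: open_imp_gdelta_in)
    moreover have "(\<Inter>m\<in>{0<..}. U m) = G" by (auto simp: G_def U_def)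
    ultimately show ?thesis by simp
  qed
  moreover have "minimal_topology closure_of G = topspace minimal_topology"
  proof
    show "minimal_topology closure_of G \<subseteq> topspace minimal_topology" by (rule closure_of_subset_topspace)
    show "topspace minimal_topology \<subseteq> minimal_topology closure_of G"
    proof
      fix X assume "X \<in> topspace minimal_topology"
      then have X: "X \<in> infinite_minimal_subshifts" by (simp add: top)
      have "\<exists>Y\<in>G. Y \<in> subshift_space.mball X e" if "0 < e" for e
      proof -
        obtain n where n: "(1/2::real) ^ n < e" using real_arch_pow_inv[OF \<open>0 < e\<close>, of "1/2"] by auto
        obtain Y where Y: "Y \<in> infinite_minimal_subshifts" "language n Y = language n X"
            "\<And>m. 0 < m \<Longrightarrow> two_block_tilable m Y"
          using tilable_dense[OF X, of n] by blast
        have "subshift_dist X Y < e"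
          using dist_less_if_language_eq[of n X Y] Y(2) n by simp
        then show ?thesis using X Y M by (intro bexI[of _ Y]) (auto simp: G_def)
      qed
      then have "X \<in> subshift_space.mtopology closure_of G"
        unfolding subshift_space.metric_closure_of using X M by auto
      then show "X \<in> minimal_topology closure_of G"
        unfolding minimal_topology_def closure_of_subtopology
        using X by (auto simp: G_def Int_absorb1 Collect_conj_eq)
    qed
  qed
  ultimately show ?thesis
    unfolding generic_in_def top by blast
qed

end
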